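(* Let $m$ be a fixed positive integer, let $(r_n)$ be a sequence of real numbers in $(0,0.5)$ with $r_n=o(1)$ and $nr_n^m=\omega(1)$ as $n\to\infty$, and let $F$ be a fixed probability distribution on $[0,1]^m$ with continuous probability density function $f$. For each $n$ let $A\sim\mathcal{G}_{n,m}(r_n,F)$ be the adjacency matrix of a random geometric graph. Suppose that the alternative hypothesis $H_1: F\neq U([0,1]^m)$ holds, i.e. $F$ is not the uniform distribution on $[0,1]^m$. Then $$\frac{\sqrt{2}\,T_n}{n^5\bar{A}_n\hat{\sigma}_{n2}}=\Theta\left(\sqrt{n}\sqrt{nr_n^m}\,\Delta_f\right)(1+o_P(1)),$$ where $$\Delta_f=\int_{[0,1]^m}f^{4}(x)\,dx\int_{[0,1]^m}f^{2}(x)\,dx-\left(\int_{[0,1]^m}f^{3}(x)\,dx\right)^2,$$ $$T_{n}=\left(\sum_{i\neq j\neq k\neq l}A_{ij}A_{jk}A_{kl}\right)\left(\sum_{i\neq j}A_{ij}\right)-\left(\sum_{i\neq j\neq k}A_{ij}A_{jk}\right)^2,$$ $$\bar{A}_n=\frac{1}{n(n-1)}\sum_{i\neq j}A_{ij},\qquad \hat{\sigma}_{n2}^2=\frac{4\sum_{i_1\neq i_2\neq \dots \neq i_6}A_{i_1i_2}A_{i_2i_3}A_{i_3i_4}A_{i_4i_5}A_{i_5i_6}A_{i_6i_1}}{n^6},$$ and $\hat\sigma_{n2}$ is the nonnegative square root of $\hat\sigma_{n2}^2$.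
   Context: Random geometric graph: let $r_n\in(0,0.5)$, let $m$ be a positive integer and $F$ a probability distribution on $[0,1]^m$. Given i.i.d. random vectors $X_1,\dots,X_n\sim F$, $X_i=(X_{i1},\dots,X_{im})$, the graph $\mathcal{G}_{n,m}(r_n,F)$ on the node set $\{1,\dots,n\}$ has symmetric adjacency matrix $A$ with $A_{ii}=0$ and, for $i\neq j$, $A_{ij}=I[d(X_i,X_j)\leq r_n]$ ($I$ denotes the indicator), where $$d(X_i,X_j)=\max_{1\leq k\leq m}\Big\{\min\{|X_{ik}-X_{jk}|,\,1-|X_{ik}-X_{jk}|\}\Big\}$$ is the $L_\infty$ distance on the $m$-dimensional torus. Notation: $\sum_{i_1\neq i_2\neq\dots\neq i_t}$ denotes summation over all $i_1,\dots,i_t\in\{1,\dots,n\}$ that are pairwise distinct, i.e. $|\{i_1,\dots,i_t\}|=t$. $a_n=o(b_n)$ means $|a_n/b_n|\to0$; $a_n=\omega(b_n)$ means $|a_n/b_n|\to\infty$; $a_n=\Theta(b_n)$ means $c_1\le|a_n/b_n|\le c_2$ for some positive constants $c_1,c_2$ and all large $n$. $o_P(1)$ denotes a sequence of random variables converging to $0$ in probability. An identity $Y_n=\Theta(b_n)(1+o_P(1))$ for random $Y_n$ means that there is a deterministic sequence $a_n=\Theta(b_n)$ with $Y_n=a_n(1+o_P(1))$. *)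

theory Defs
  imports "HOL-Probability.Probability" "HOL-Library.Landau_Symbols"
begin

definition torus_dist :: "real ^ 'm \<Rightarrow> real ^ 'm \<Rightarrow> real" where
  "torus_dist x y = (MAX k. min \<bar>x $ k - y $ k\<bar> (1 - \<bar>x $ k - y $ k\<bar>))"

definition rgg_adj :: "real \<Rightarrow> (nat \<Rightarrow> real ^ 'm) \<Rightarrow> nat \<Rightarrow> nat \<Rightarrow> real" where
  "rgg_adj r x i j = (if i \<noteq> j \<and> torus_dist (x i) (x j) \<le> r then 1 else 0)"

text \<open>\<open>random_geometric_graph M n r F A\<close>: on the probability space \<open>M\<close>, the random matrix \<open>A\<close>
  with index set \<open>{1..n}\<close> is the adjacency matrix built from an i.i.d. sample of size \<open>n\<close> from \<open>F\<close>.\<close>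
definition random_geometric_graph ::
    "'a measure \<Rightarrow> nat \<Rightarrow> real \<Rightarrow> (real ^ 'm) measure \<Rightarrow> ('a \<Rightarrow> nat \<Rightarrow> nat \<Rightarrow> real) \<Rightarrow> bool" where
  "random_geometric_graph M n r F A \<longleftrightarrow>
     prob_space M \<and>
     (\<exists>X. prob_space.indep_vars M (\<lambda>_. borel) X {1..n} \<and>
          (\<forall>i\<in>{1..n}. distr M borel (X i) = F) \<and>
          (\<forall>\<omega>\<in>space M. \<forall>i\<in>{1..n}. \<forall>j\<in>{1..n}. A \<omega> i j = rgg_adj r (\<lambda>k. X k \<omega>) i j))"

definition distinct_tuples :: "nat \<Rightarrow> nat \<Rightarrow> nat list set" where
  "distinct_tuples t n = {v. length v = t \<and> distinct v \<and> set v \<subseteq> {1..n}}"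

definition T_stat :: "nat \<Rightarrow> (nat \<Rightarrow> nat \<Rightarrow> real) \<Rightarrow> real" where
  "T_stat n A =
     (\<Sum>v\<in>distinct_tuples 4 n. A (v!0) (v!1) * A (v!1) (v!2) * A (v!2) (v!3)) *
     (\<Sum>v\<in>distinct_tuples 2 n. A (v!0) (v!1)) -
     (\<Sum>v\<in>distinct_tuples 3 n. A (v!0) (v!1) * A (v!1) (v!2))\<^sup>2"

definition A_bar :: "nat \<Rightarrow> (nat \<Rightarrow> nat \<Rightarrow> real) \<Rightarrow> real" where
  "A_bar n A = 1 / (real n * (real n - 1)) * (\<Sum>v\<in>distinct_tuples 2 n. A (v!0) (v!1))"

text \<open>This is the square root, not the squared quantity; the subscript 2 is part of the name.\<close>
definition sigma_hat_2 :: "nat \<Rightarrow> (nat \<Rightarrow> nat \<Rightarrow> real) \<Rightarrow> real" where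
  "sigma_hat_2 n A = sqrt
     (4 * (\<Sum>v\<in>distinct_tuples 6 n.
        A (v!0) (v!1) * A (v!1) (v!2) * A (v!2) (v!3) * A (v!3) (v!4) * A (v!4) (v!5) * A (v!5) (v!0))
      / real n ^ 6)"

definition Delta :: "(real ^ 'm \<Rightarrow> real) \<Rightarrow> real" where
  "Delta f =
     (LINT x:cbox 0 1|lborel. f x ^ 4) * (LINT x:cbox 0 1|lborel. f x ^ 2) -
     (LINT x:cbox 0 1|lborel. f x ^ 3)\<^sup>2"

text \<open>The random variables may live on a different probability space for each \<open>n \<ge> 1\<close>.\<close>
definition o_P_one :: "(nat \<Rightarrow> 'a measure) \<Rightarrow> (nat \<Rightarrow> 'a \<Rightarrow> real) \<Rightarrow> bool" where
  "o_P_one M e \<longleftrightarrow>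
     (\<forall>n\<ge>1. e n \<in> borel_measurable (M n)) \<and>
     (\<forall>\<epsilon>>0. (\<lambda>n. measure (M n) {\<omega>\<in>space (M n). \<bar>e n \<omega>\<bar> > \<epsilon>}) \<longlonglongrightarrow> 0)"

text \<open>\<open>Y\<^sub>n = \<Theta>(b\<^sub>n)(1 + o\<^sub>P(1))\<close>, where the factor \<open>\<Theta>(b\<^sub>n)\<close> is a deterministic sequence.\<close>
definition Theta_in_probability ::
    "(nat \<Rightarrow> 'a measure) \<Rightarrow> (nat \<Rightarrow> 'a \<Rightarrow> real) \<Rightarrow> (nat \<Rightarrow> real) \<Rightarrow> bool" where
  "Theta_in_probability M Y b \<longleftrightarrow>
     (\<exists>a e. a \<in> \<Theta>(b) \<and> o_P_one M e \<and>
            (\<forall>n\<ge>1. \<forall>\<omega>\<in>space (M n). Y n \<omega> = a n * (1 + e n \<omega>)))"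

end

theory Submission
  imports Defs
begin

text \<open>Every statistic involved is a sum over distinct tuples of products of adjacency indicators along
  a path, possibly closed up to a cycle. Since each summand is dominated by a path indicator, the second
  moment of a pair of overlapping tuples is at most \<open>q ^ (number of vertices - 1)\<close>, where \<open>q\<close> is
  of order \<open>r ^ m\<close>; counting such pairs gives a relative variance \<open>O(1/n)\<close> as soon as \<open>n q \<ge> 1\<close>, so
  that all counts concentrate by Chebyshev's inequality. The normalised mean number of paths on \<open>t\<close>
  vertices converges to a multiple of the integral of \<open>f ^ t\<close>, because at interior points averaging over
  a small box tends to multiplication by \<open>f\<close>. Finally \<open>Delta f\<close> is a Cauchy--Schwarz defect; if it
  vanishes, \<open>f\<close> takes at most two values and is constant by connectedness of the cube.\<close>

subsection \<open>Path statistics of an i.i.d. sample\<close>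

text \<open>\<open>T_stat\<close> is a difference of two products of counts, both of order
  \<open>n^6 q^4\<close>. Concentration of each count controls this difference up to a relative
  error \<open>o(1)\<close> because the limit of the normalised difference, a multiple of
  \<open>Delta f\<close>, is strictly positive. The scale is \<open>q = K 3^m (2 r)^m\<close>, a
  bound for the edge probability valid at every point. Since \<open>f\<close> may vanish inside the
  cube, no matching pointwise lower bound need exist, and lower bounds come from integrated moments
  instead. Dividing \<open>n^6 q^4\<close> by \<open>n^5\<close>, by \<open>A_bar\<close> of order
  \<open>q\<close> and by \<open>sigma_hat_2\<close> of order \<open>q^(5/2)\<close> leaves
  \<open>n sqrt q\<close>, that is, \<open>sqrt n * sqrt (n r^m)\<close> up to constants. Pairs of
  \<open>t\<close>-tuples with \<open>u\<close> distinct vertices together contribute at most a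
  constant times \<open>n^u q^(u-1)\<close>; under \<open>n q >= 1\<close> the dominating
  overlapping case is \<open>u = 2 t - 1\<close>, one factor \<open>n\<close> below the squared
  mean. The mean number of 6-cycles is only enclosed between constants, and its value is absorbed
  into the deterministic factor, as \<open>\<Theta>\<close> permits.\<close>

fun path_weight :: "('b \<Rightarrow> 'b \<Rightarrow> real) \<Rightarrow> (nat \<Rightarrow> 'b) \<Rightarrow> nat list \<Rightarrow> real" where
  "path_weight k x (a # b # w) = k (x a) (x b) * path_weight k x (b # w)"
| "path_weight k x _ = 1"

text \<open>Products of kernels along the edges of a tree: each leaf integrates to at most \<open>q\<close>, and two
  paths that share a vertex contain a spanning tree of their union.\<close>
inductive tree_weight :: "('b \<Rightarrow> 'b \<Rightarrow> real) \<Rightarrow> nat set \<Rightarrow> ((nat \<Rightarrow> 'b) \<Rightarrow> real) \<Rightarrow> bool" for k where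
  root: "tree_weight k {a} (\<lambda>x. 1)"
| leaf: "tree_weight k V g \<Longrightarrow> a \<in> V \<Longrightarrow> b \<notin> V \<Longrightarrow> tree_weight k (insert b V) (\<lambda>x. g x * k (x a) (x b))"

lemma tree_weight_finite: "tree_weight k V g \<Longrightarrow> finite V"
  by (induction rule: tree_weight.induct) auto

lemma path_weight_append: "path_weight k x (u @ c # w) = path_weight k x (u @ [c]) * path_weight k x (c # w)"
  by (induction k x u rule: path_weight.induct) auto

lemma path_weight_restrict: "set w \<subseteq> V \<Longrightarrow> path_weight k (restrict x V) w = path_weight k x w"
  by (induction k x w rule: path_weight.induct) auto

text \<open>Integrating out the end vertex of a path applies this operator to the function attached
  to that vertex, so mean path weights are integrals of its iterates.\<close>

definition kernel_op :: "'b measure \<Rightarrow> ('b \<Rightarrow> 'b \<Rightarrow> real) \<Rightarrow> ('b \<Rightarrow> real) \<Rightarrow> 'b \<Rightarrow> real" where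
  "kernel_op F k g y = (\<integral>z. k y z * g z \<partial>F)"

text \<open>\<open>q\<close> need not be the exact mean degree. It bounds the edge probability at
  every vertex, so that removing a leaf from a tree costs a factor of at most
  \<open>q\<close>.\<close>

locale bounded_kernel = F: prob_space F
  for F :: "'b measure" and k :: "'b \<Rightarrow> 'b \<Rightarrow> real" and q :: real +
  assumes space_F: "space F = UNIV"
    and meas_k: "(\<lambda>z. k (fst z) (snd z)) \<in> borel_measurable (F \<Otimes>\<^sub>M F)"
    and k_nonneg: "\<And>y z. 0 \<le> k y z"
    and k_le_1: "\<And>y z. k y z \<le> 1"
    and k_commute: "\<And>y z. k y z = k z y"
    and k_int_le: "\<And>y. (\<integral>z. k y z \<partial>F) \<le> q"
begin

abbreviation op :: "('b \<Rightarrow> real) \<Rightarrow> 'b \<Rightarrow> real" where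
  "op \<equiv> kernel_op F k"

lemma measurable_k [measurable (raw)]:
  assumes "g \<in> measurable N F" "h \<in> measurable N F"
  shows "(\<lambda>x. k (g x) (h x)) \<in> borel_measurable N"
  using measurable_compose[OF measurable_Pair[OF assms] meas_k] by simp

lemma q_nonneg: "0 \<le> q"
proof -
  have "0 \<le> (\<integral>z. k y z \<partial>F)" for y using k_nonneg by simp
  then show ?thesis using k_int_le order_trans by blast
qed

lemma measurable_op [measurable]: "g \<in> borel_measurable F \<Longrightarrow> op g \<in> borel_measurable F"
  unfolding kernel_op_def
proof -
  assume [measurable]: "g \<in> borel_measurable F"
  show "(\<lambda>y. \<integral>z. k y z * g z \<partial>F) \<in> borel_measurable F"
    by (rule F.borel_measurable_lebesgue_integral) measurable
qed

lemma op_nonneg: "(\<And>z. 0 \<le> g z) \<Longrightarrow> 0 \<le> op g y"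
  unfolding kernel_op_def using k_nonneg by (intro Bochner_Integration.integral_nonneg) auto

lemma abs_op_le:
  assumes [measurable]: "g \<in> borel_measurable F" and g: "\<And>z. \<bar>g z\<bar> \<le> B"
  shows "\<bar>op g y\<bar> \<le> B * q"
proof -
  have B: "0 \<le> B" using g[of undefined] by linarith
  have [measurable]: "y \<in> space F" by (simp add: space_F)
  have *: "\<bar>k y z * g z\<bar> \<le> k y z * B" for z
    using g k_nonneg by (auto simp: abs_mult intro!: mult_left_mono)
  have **: "\<bar>k y z * B\<bar> \<le> B" for z
    using k_nonneg k_le_1 B by (auto simp: abs_mult intro!: mult_left_le_one_le)
  have "\<bar>op g y\<bar> \<le> (\<integral>z. \<bar>k y z * g z\<bar> \<partial>F)"
    unfolding kernel_op_def by (rule integral_abs_bound)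
  also have "\<dots> \<le> (\<integral>z. k y z * B \<partial>F)"
  proof (intro integral_mono)
    show "integrable F (\<lambda>z. \<bar>k y z * g z\<bar>)"
      by (rule F.integrable_const_bound[where B=B])
         (use * ** in \<open>auto intro!: AE_I2 intro: order_trans[OF _ order_trans[OF abs_ge_self]]\<close>)
    show "integrable F (\<lambda>z. k y z * B)"
      by (rule F.integrable_const_bound[where B=B]) (use ** in auto)
  qed (use * in auto)
  also have "\<dots> \<le> B * q" using mult_left_mono[OF k_int_le[of y] B] by (simp add: mult.commute)
  finally show ?thesis .
qed

lemma measurable_path_weight:
  "set w \<subseteq> V \<Longrightarrow> (\<lambda>x. path_weight k x w) \<in> borel_measurable (PiM V (\<lambda>_. F))"
proof (induction w rule: induct_list012)
  case (3 a b w)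
  have [measurable]: "(\<lambda>x. path_weight k x (b # w)) \<in> borel_measurable (PiM V (\<lambda>_. F))"
    using 3 by auto
  have [measurable]: "(\<lambda>x. x a) \<in> measurable (PiM V (\<lambda>_. F)) F" "(\<lambda>x. x b) \<in> measurable (PiM V (\<lambda>_. F)) F"
    using 3 by (auto intro!: measurable_component_singleton)
  show ?case by simp
qed auto

lemma path_weight_range: "0 \<le> path_weight k x w \<and> path_weight k x w \<le> 1"
  by (induction w rule: induct_list012) (auto intro: mult_le_one simp: k_nonneg k_le_1)

lemma path_weight_rev: "path_weight k x (rev w) = path_weight k x w"
proof (induction w rule: induct_list012)
  case (3 a b w)
  have "path_weight k x (rev (a # b # w)) = path_weight k x (rev w @ b # [a])" by simp
  also have "\<dots> = path_weight k x (rev (b # w)) * k (x b) (x a)"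
    by (subst path_weight_append) simp
  finally show ?case using 3 k_commute by simp
qed auto

lemma tree_weight_range: "tree_weight k V g \<Longrightarrow> 0 \<le> g x \<and> g x \<le> 1"
  by (induction rule: tree_weight.induct) (auto intro: mult_le_one simp: k_nonneg k_le_1)

lemma tree_weight_restrict: "tree_weight k V g \<Longrightarrow> V \<subseteq> W \<Longrightarrow> g (restrict x W) = g x"
  by (induction rule: tree_weight.induct) (auto simp: subset_iff)

lemma measurable_tree_weight:
  "tree_weight k V g \<Longrightarrow> V \<subseteq> W \<Longrightarrow> g \<in> borel_measurable (PiM W (\<lambda>_. F))"
proof (induction rule: tree_weight.induct)
  case (leaf V g a b)
  have [measurable]: "g \<in> borel_measurable (PiM W (\<lambda>_. F))" using leaf by auto
  have [measurable]: "(\<lambda>x. x a) \<in> measurable (PiM W (\<lambda>_. F)) F" "(\<lambda>x. x b) \<in> measurable (PiM W (\<lambda>_. F)) F"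
    using leaf by (auto intro!: measurable_component_singleton)
  show ?case by simp
qed auto

text \<open>Walk along \<open>w\<close>: a vertex not yet in the tree is attached as a leaf, while
  an edge leading back to a known vertex is discarded, which is harmless because the kernel is at
  most 1.\<close>

lemma tree_weight_extend:
  "tree_weight k V g \<Longrightarrow> a \<in> V \<Longrightarrow>
    \<exists>g'. tree_weight k (V \<union> set w) g' \<and> (\<forall>x. g x * path_weight k x (a # w) \<le> g' x)"
proof (induction w arbitrary: V g a)
  case Nil
  then show ?case by auto
next
  case (Cons b w)
  show ?case
  proof (cases "b \<in> V")
    case True
    from Cons.IH[OF Cons.prems(1) True] obtain g' where
      g': "tree_weight k (V \<union> set w) g'" "\<And>x. g x * path_weight k x (b # w) \<le> g' x" by blast
    have "g x * path_weight k x (a # b # w) \<le> g' x" for x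
    proof -
      have "k (x a) (x b) * (g x * path_weight k x (b # w)) \<le> g x * path_weight k x (b # w)"
        using tree_weight_range[OF Cons.prems(1)] path_weight_range k_le_1 k_nonneg
        by (intro mult_left_le_one_le) auto
      with g'(2)[of x] show ?thesis by (simp add: mult_ac)
    qed
    with g' True show ?thesis by (intro exI[of _ g']) (auto simp: insert_absorb)
  next
    case False
    have "tree_weight k (insert b V) (\<lambda>x. g x * k (x a) (x b))"
      using Cons.prems False by (intro tree_weight.leaf)
    from Cons.IH[OF this, of b] obtain g' where
      g': "tree_weight k (insert b V \<union> set w) g'"
        "\<And>x. g x * k (x a) (x b) * path_weight k x (b # w) \<le> g' x" by blast
    then show ?thesis by (intro exI[of _ g']) (auto simp: mult.assoc)
  qed
qed

lemma tree_weight_of_path: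
  assumes "v \<noteq> []"
  shows "\<exists>g. tree_weight k (set v) g \<and> (\<forall>x. path_weight k x v \<le> g x)"
proof -
  obtain a w where v: "v = a # w" using assms by (cases v) auto
  from tree_weight_extend[OF tree_weight.root[of k a], of a w] show ?thesis by (simp add: v)
qed

text \<open>Cut \<open>w\<close> at a shared vertex \<open>c\<close> and grow the tree of
  \<open>v\<close> along both arms, each walked outwards from \<open>c\<close>. Symmetry of the
  kernel allows the first arm to be reversed.\<close>

lemma tree_weight_of_overlapping_paths:
  assumes "set v \<inter> set w \<noteq> {}"
  shows "\<exists>g. tree_weight k (set v \<union> set w) g \<and> (\<forall>x. path_weight k x v * path_weight k x w \<le> g x)"
proof -
  obtain c where c: "c \<in> set v" "c \<in> set w" using assms by auto
  obtain w1 w2 where w: "w = w1 @ c # w2" using c split_list by metis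
  obtain g1 where g1: "tree_weight k (set v) g1" "\<And>x. path_weight k x v \<le> g1 x"
    using tree_weight_of_path[of v] c by fastforce
  obtain g2 where g2: "tree_weight k (set v \<union> set (rev w1)) g2"
      "\<And>x. g1 x * path_weight k x (c # rev w1) \<le> g2 x"
    using tree_weight_extend[OF g1(1) c(1), of "rev w1"] by blast
  obtain g3 where g3: "tree_weight k (set v \<union> set (rev w1) \<union> set w2) g3"
      "\<And>x. g2 x * path_weight k x (c # w2) \<le> g3 x"
    using tree_weight_extend[OF g2(1), of c w2] c by blast
  have "path_weight k x v * path_weight k x w \<le> g3 x" for x
  proof -
    have "path_weight k x w = path_weight k x (c # rev w1) * path_weight k x (c # w2)"
      unfolding w by (subst path_weight_append) (simp flip: path_weight_rev[of x "w1 @ [c]"])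
    then have "path_weight k x v * path_weight k x w
       \<le> (g1 x * path_weight k x (c # rev w1)) * path_weight k x (c # w2)"
      using g1(2)[of x] path_weight_range by (auto simp: mult.assoc intro!: mult_right_mono)
    also have "\<dots> \<le> g2 x * path_weight k x (c # w2)"
      using g2(2)[of x] path_weight_range by (auto intro!: mult_right_mono)
    also have "\<dots> \<le> g3 x" by (rule g3(2))
    finally show ?thesis .
  qed
  with g3 show ?thesis by (intro exI[of _ g3]) (auto simp: w insert_absorb Un_ac c)
qed

end

section \<open>Expected weights of trees, paths and stars in an independent sample\<close>

locale iid_kernel = prob_space M + bounded_kernel F k q
  for M :: "'a measure" and F :: "'b measure" and k q +
  fixes X :: "nat \<Rightarrow> 'a \<Rightarrow> 'b" and I :: "nat set"
  assumes indep: "indep_vars (\<lambda>_. F) X I"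
    and distr_X: "\<And>i. i \<in> I \<Longrightarrow> distr M F (X i) = F"
begin

lemma measurable_X [measurable]: "i \<in> I \<Longrightarrow> X i \<in> measurable M F"
  using indep by (auto simp: indep_vars_def)

text \<open>Fubini: given the vertices in \<open>V\<close>, the leaf \<open>b\<close> is independent
  and sees only its neighbour \<open>a\<close>. The factor \<open>h\<close> at \<open>b\<close>
  stands for whatever earlier integrations have left there.\<close>

lemma expectation_leaf:
  assumes V: "V \<subseteq> I" "b \<in> I" "b \<notin> V"
    and [measurable]: "g \<in> borel_measurable (PiM V (\<lambda>_. F))" and g: "\<And>x. \<bar>g x\<bar> \<le> B" "\<And>x. g (restrict x V) = g x"
    and a: "a \<in> V"
    and [measurable]: "h \<in> borel_measurable F" and h: "\<And>z. \<bar>h z\<bar> \<le> C"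
  shows "expectation (\<lambda>\<omega>. g (\<lambda>i. X i \<omega>) * k (X a \<omega>) (X b \<omega>) * h (X b \<omega>))
       = expectation (\<lambda>\<omega>. g (\<lambda>i. X i \<omega>) * op h (X a \<omega>))"
proof -
  let ?N = "PiM V (\<lambda>_. F)"
  let ?Y = "\<lambda>\<omega>. restrict (\<lambda>i. X i \<omega>) V"
  have Y[measurable]: "?Y \<in> measurable M ?N"
    using V by (intro measurable_restrict measurable_X) auto
  have Xb[measurable]: "X b \<in> measurable M F" using V by auto
  have ca[measurable]: "(\<lambda>x. x a) \<in> measurable ?N F" using a by (rule measurable_component_singleton)
  \<comment> \<open>\<open>indep_var_restrict\<close> speaks of restrictions of the sample to
    disjoint index sets, so the single variable \<open>X b\<close> is carried as a function on
    \<open>{b}\<close>.\<close>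
  let ?Nb = "PiM {b} (\<lambda>_. F)"
  let ?Yb = "\<lambda>\<omega>. restrict (\<lambda>i. X i \<omega>) {b}"
  have Yb[measurable]: "?Yb \<in> measurable M ?Nb"
    using V by (intro measurable_restrict measurable_X) auto
  have cb[measurable]: "(\<lambda>x. x b) \<in> measurable ?Nb F" by (rule measurable_component_singleton) simp
  have "indep_var ?N ?Y ?Nb ?Yb"
    by (rule indep_var_restrict[OF indep]) (use V in auto)
  then have j: "distr M ?N ?Y \<Otimes>\<^sub>M distr M ?Nb ?Yb = distr M (?N \<Otimes>\<^sub>M ?Nb) (\<lambda>\<omega>. (?Y \<omega>, ?Yb \<omega>))"
    unfolding indep_var_distribution_eq by simp
  interpret N: prob_space "distr M ?N ?Y" by (rule prob_space_distr) simp
  interpret Nb: prob_space "distr M ?Nb ?Yb" by (rule prob_space_distr) simp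
  interpret P: pair_prob_space "distr M ?N ?Y" "distr M ?Nb ?Yb" ..
  let ?H = "\<lambda>z. g (fst z) * k (fst z a) (snd z b) * h (snd z b)"
  have Hm[measurable]: "?H \<in> borel_measurable (?N \<Otimes>\<^sub>M ?Nb)" by measurable
  have B: "0 \<le> B" "0 \<le> C" using g(1)[of undefined] h[of undefined] by linarith+
  have Hb: "\<bar>?H z\<bar> \<le> B * C" for z
  proof -
    have "\<bar>g (fst z)\<bar> * \<bar>k (fst z a) (snd z b)\<bar> * \<bar>h (snd z b)\<bar> \<le> B * 1 * C"
      using g h k_nonneg k_le_1 B by (intro mult_mono) auto
    then show ?thesis by (simp add: abs_mult)
  qed
  have inte: "integrable (distr M ?N ?Y \<Otimes>\<^sub>M distr M ?Nb ?Yb) ?H"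
    by (rule P.integrable_const_bound[where B="B*C"]) (use Hb in auto)
  have inner: "(\<integral>y. ?H (x, y) \<partial>distr M ?Nb ?Yb) = g x * op h (x a)" if x: "x \<in> space ?N" for x
  proof -
    have [measurable]: "x a \<in> space F" using x a by (auto simp: space_PiM)
    have "(\<integral>y. ?H (x, y) \<partial>distr M ?Nb ?Yb) = expectation (\<lambda>\<omega>. g x * k (x a) (X b \<omega>) * h (X b \<omega>))"
      using x by (subst integral_distr) auto
    also have "\<dots> = (\<integral>z. g x * k (x a) z * h z \<partial>distr M F (X b))"
      by (subst integral_distr) auto
    also have "\<dots> = g x * op h (x a)"
      unfolding distr_X[OF V(2)] kernel_op_def by (simp add: mult.assoc)
    finally show ?thesis .
  qed
  have "expectation (\<lambda>\<omega>. g (\<lambda>i. X i \<omega>) * k (X a \<omega>) (X b \<omega>) * h (X b \<omega>))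
     = expectation (\<lambda>\<omega>. ?H (?Y \<omega>, ?Yb \<omega>))"
    using a by (simp add: g(2))
  also have "\<dots> = integral\<^sup>L (distr M (?N \<Otimes>\<^sub>M ?Nb) (\<lambda>\<omega>. (?Y \<omega>, ?Yb \<omega>))) ?H"
    by (subst integral_distr) auto
  also have "\<dots> = integral\<^sup>L (distr M ?N ?Y \<Otimes>\<^sub>M distr M ?Nb ?Yb) ?H" by (simp add: j)
  also have "\<dots> = (\<integral>x. (\<integral>y. ?H (x, y) \<partial>distr M ?Nb ?Yb) \<partial>distr M ?N ?Y)"
    using P.integral_fst'[OF inte] by simp
  also have "\<dots> = (\<integral>x. g x * op h (x a) \<partial>distr M ?N ?Y)"
    using inner by (intro Bochner_Integration.integral_cong) auto
  also have "\<dots> = expectation (\<lambda>\<omega>. g (?Y \<omega>) * op h (?Y \<omega> a))"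
    by (subst integral_distr) auto
  also have "\<dots> = expectation (\<lambda>\<omega>. g (\<lambda>i. X i \<omega>) * op h (X a \<omega>))"
    using a by (simp add: g(2))
  finally show ?thesis .
qed

lemma measurable_restrict_sample:
  assumes "V \<subseteq> I" "g \<in> borel_measurable (PiM V (\<lambda>_. F))" "\<And>x. g (restrict x V) = g x"
  shows "(\<lambda>\<omega>. g (\<lambda>i. X i \<omega>)) \<in> borel_measurable M"
proof -
  have "(\<lambda>\<omega>. restrict (\<lambda>i. X i \<omega>) V) \<in> measurable M (PiM V (\<lambda>_. F))"
    using assms(1) by (intro measurable_restrict measurable_X) auto
  from measurable_compose[OF this assms(2)] show ?thesis by (simp add: assms(3))
qed

text \<open>Leaves are integrated out in reverse order of attachment. Each gives a factor
  \<open>op (\<lambda>_. 1)\<close>, bounded by \<open>q\<close>, and every vertex except the root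
  was once a leaf.\<close>

lemma expectation_tree_le:
  "tree_weight k V g \<Longrightarrow> V \<subseteq> I \<Longrightarrow> expectation (\<lambda>\<omega>. g (\<lambda>i. X i \<omega>)) \<le> q ^ (card V - 1)"
proof (induction rule: tree_weight.induct)
  case (root a)
  then show ?case by (simp add: prob_space)
next
  case (leaf V g a b)
  note r = tree_weight_range[OF leaf(1)]
  have m: "g \<in> borel_measurable (PiM V (\<lambda>_. F))" using measurable_tree_weight[OF leaf(1)] by auto
  have m': "(\<lambda>\<omega>. g (\<lambda>i. X i \<omega>)) \<in> borel_measurable M"
    using leaf by (intro measurable_restrict_sample[OF _ m] tree_weight_restrict[OF leaf(1)]) auto
  have Xa: "X a \<in> measurable M F" using leaf by auto
  have "expectation (\<lambda>\<omega>. g (\<lambda>i. X i \<omega>) * k (X a \<omega>) (X b \<omega>) * 1)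
      = expectation (\<lambda>\<omega>. g (\<lambda>i. X i \<omega>) * op (\<lambda>_. 1) (X a \<omega>))"
    using leaf r tree_weight_restrict[OF leaf(1) order_refl]
    by (intro expectation_leaf[where V=V and B=1 and C=1] m) (auto simp del: restrict_apply)
  also have "\<dots> \<le> expectation (\<lambda>\<omega>. g (\<lambda>i. X i \<omega>) * q)"
  proof (intro integral_mono)
    have o: "0 \<le> op (\<lambda>_. 1) y \<and> op (\<lambda>_. 1) y \<le> q" for y
      using op_nonneg[of "\<lambda>_. 1" y] k_int_le[of y] by (simp add: kernel_op_def)
    show "integrable M (\<lambda>\<omega>. g (\<lambda>i. X i \<omega>) * q)"
      by (rule integrable_const_bound[where B="q"])
         (use m' r q_nonneg in \<open>auto simp: abs_mult intro!: AE_I2 mult_left_le_one_le\<close>)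
    have "(\<lambda>\<omega>. op (\<lambda>_. 1) (X a \<omega>)) \<in> borel_measurable M"
      by (rule measurable_compose[OF Xa]) simp
    moreover have "g x * op (\<lambda>_. 1) y \<le> 1 * q" for x y
      using r o by (intro mult_mono) auto
    ultimately show "integrable M (\<lambda>\<omega>. g (\<lambda>i. X i \<omega>) * op (\<lambda>_. 1) (X a \<omega>))"
      by (intro integrable_const_bound[where B=q])
         (use m' r o in \<open>auto simp: abs_mult intro!: AE_I2\<close>)
    show "g (\<lambda>i. X i \<omega>) * op (\<lambda>_. 1) (X a \<omega>) \<le> g (\<lambda>i. X i \<omega>) * q" for \<omega>
      using o r by (intro mult_left_mono) auto
  qed
  also have "\<dots> = expectation (\<lambda>\<omega>. g (\<lambda>i. X i \<omega>)) * q" by simp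
  also have "\<dots> \<le> q ^ (card V - 1) * q" using leaf q_nonneg by (intro mult_right_mono) auto
  also have "\<dots> = q ^ (card (insert b V) - 1)"
  proof -
    have "finite V" "V \<noteq> {}" using tree_weight_finite leaf by auto
    then have "card V > 0" by (simp add: card_gt_0_iff)
    then show ?thesis using leaf \<open>finite V\<close> by (cases "card V") (auto simp: mult.commute)
  qed
  finally show ?case by simp
qed

text \<open>The end function \<open>h\<close> is arbitrary so that the induction can run from the
  end of the path: dropping the last vertex replaces \<open>h\<close> by
  \<open>op h\<close>.\<close>

lemma expectation_path:
  assumes "set w \<subseteq> I" "distinct w" "w \<noteq> []"
    and "h \<in> borel_measurable F" "\<And>z. \<bar>h z\<bar> \<le> C"
  shows "expectation (\<lambda>\<omega>. path_weight k (\<lambda>i. X i \<omega>) w * h (X (last w) \<omega>))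
       = (\<integral>y. (op ^^ (length w - 1)) h y \<partial>F)"
  using assms
proof (induction w arbitrary: h C rule: rev_induct)
  case (snoc b u)
  note [measurable] = snoc.prems(4)
  have b: "X b \<in> measurable M F" using snoc by auto
  show ?case
  proof (cases u rule: rev_cases)
    case Nil
    have "expectation (\<lambda>\<omega>. h (X b \<omega>)) = (\<integral>y. h y \<partial>distr M F (X b))"
      using b by (subst integral_distr) auto
    then show ?thesis using Nil snoc distr_X[of b] by simp
  next
    case (snoc u' a)
    note IH = snoc.IH[of "op h" "C * q"] and pr = snoc.prems
    have "expectation (\<lambda>\<omega>. path_weight k (\<lambda>i. X i \<omega>) (u @ [b]) * h (X (last (u @ [b])) \<omega>))
       = expectation (\<lambda>\<omega>. path_weight k (\<lambda>i. X i \<omega>) u * k (X a \<omega>) (X b \<omega>) * h (X b \<omega>))"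
      using path_weight_append[of k _ u' a "[b]"] by (simp add: \<open>u = _\<close>)
    also have "\<dots> = expectation (\<lambda>\<omega>. path_weight k (\<lambda>i. X i \<omega>) u * op h (X a \<omega>))"
      using pr path_weight_range \<open>u = _\<close>
      by (intro expectation_leaf[where V="set u" and B=1 and C=C] measurable_path_weight path_weight_restrict) auto
    also have "\<dots> = (\<integral>y. (op ^^ (length u - 1)) (op h) y \<partial>F)"
      using IH pr abs_op_le[OF pr(4,5)] measurable_op[OF pr(4)] \<open>u = _\<close> by simp
    also have "\<dots> = (\<integral>y. (op ^^ (length (u @ [b]) - 1)) h y \<partial>F)"
      using \<open>u = _\<close> by (simp flip: funpow_Suc_right) (simp add: funpow_swap1)
    finally show ?thesis .
  qed
qed auto

text \<open>All spokes are leaves at the same centre, so the factors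
  \<open>op (\<lambda>_. 1)\<close> multiply there instead of being nested. The function
  \<open>g\<close> accumulates them during the induction.\<close>

lemma expectation_star:
  assumes "set l \<subseteq> I" "distinct l" "a \<in> I" "a \<notin> set l"
    and "g \<in> borel_measurable F" "\<And>z. \<bar>g z\<bar> \<le> B"
  shows "expectation (\<lambda>\<omega>. g (X a \<omega>) * (\<Prod>b\<leftarrow>l. k (X a \<omega>) (X b \<omega>)))
       = (\<integral>y. g y * op (\<lambda>_. 1) y ^ length l \<partial>F)"
  using assms
proof (induction l arbitrary: g B)
  case Nil
  then have "expectation (\<lambda>\<omega>. g (X a \<omega>)) = (\<integral>y. g y \<partial>distr M F (X a))"
    by (subst integral_distr) auto
  then show ?case using Nil distr_X[of a] by simp
next
  case (Cons b l)
  note [measurable] = Cons.prems(5)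
  let ?V = "insert a (set l)"
  let ?G = "\<lambda>x. g (x a) * (\<Prod>b\<leftarrow>l. k (x a) (x b))"
  have pr: "0 \<le> (\<Prod>b\<leftarrow>l. k (x a) (x b)) \<and> (\<Prod>b\<leftarrow>l. k (x a) (x b)) \<le> 1" for x
    by (induction l) (auto intro: mult_le_one simp: k_nonneg k_le_1)
  have m: "(\<lambda>x. \<Prod>b\<leftarrow>l. k (x a) (x b)) \<in> borel_measurable (PiM ?V (\<lambda>_. F))"
  proof -
    have "set l \<subseteq> V \<Longrightarrow> a \<in> V \<Longrightarrow> (\<lambda>x. \<Prod>b\<leftarrow>l. k (x a) (x b)) \<in> borel_measurable (PiM V (\<lambda>_. F))" for V
    proof (induction l)
      case (Cons c l)
      have [measurable]: "(\<lambda>x. x c) \<in> measurable (PiM V (\<lambda>_. F)) F" "(\<lambda>x. x a) \<in> measurable (PiM V (\<lambda>_. F)) F"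
        using Cons by (auto intro!: measurable_component_singleton)
      have [measurable]: "(\<lambda>x. \<Prod>b\<leftarrow>l. k (x a) (x b)) \<in> borel_measurable (PiM V (\<lambda>_. F))"
        using Cons by auto
      show ?case by simp
    qed auto
    then show ?thesis by auto
  qed
  have [measurable]: "(\<lambda>x. x a) \<in> measurable (PiM ?V (\<lambda>_. F)) F"
    by (auto intro!: measurable_component_singleton)
  have "expectation (\<lambda>\<omega>. g (X a \<omega>) * (\<Prod>c\<leftarrow>b # l. k (X a \<omega>) (X c \<omega>)))
      = expectation (\<lambda>\<omega>. ?G (\<lambda>i. X i \<omega>) * k (X a \<omega>) (X b \<omega>) * 1)"
    by (simp add: mult_ac)
  also have "\<dots> = expectation (\<lambda>\<omega>. ?G (\<lambda>i. X i \<omega>) * op (\<lambda>_. 1) (X a \<omega>))"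
  proof (rule expectation_leaf[where V="?V" and B=B and C=1])
    show "\<bar>?G x\<bar> \<le> B" for x
    proof -
      have "\<bar>g (x a)\<bar> * \<bar>\<Prod>b\<leftarrow>l. k (x a) (x b)\<bar> \<le> B * 1"
        using Cons.prems(6)[of "x a"] pr[of x] by (intro mult_mono) auto
      then show ?thesis by (simp add: abs_mult)
    qed
    show "?G (restrict x ?V) = ?G x" for x by (simp cong: map_cong)
  qed (use Cons.prems m in auto)
  also have "\<dots> = expectation (\<lambda>\<omega>. (g (X a \<omega>) * op (\<lambda>_. 1) (X a \<omega>)) * (\<Prod>c\<leftarrow>l. k (X a \<omega>) (X c \<omega>)))"
    by (simp add: mult_ac)
  also have "\<dots> = (\<integral>y. (g y * op (\<lambda>_. 1) y) * op (\<lambda>_. 1) y ^ length l \<partial>F)"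
  proof (rule Cons.IH)
    have "\<bar>op (\<lambda>_. 1) z\<bar> \<le> 1 * q" for z by (rule abs_op_le) auto
    then have o: "\<bar>op (\<lambda>_. 1) z\<bar> \<le> q" for z by simp
    have "0 \<le> B" using Cons.prems(6)[of undefined] by linarith
    then show "\<bar>g z * op (\<lambda>_. 1) z\<bar> \<le> B * q" for z
      unfolding abs_mult using Cons.prems(6)[of z] o[of z] by (intro mult_mono) auto
  qed (use Cons.prems in auto)
  finally show ?case by (simp add: mult_ac)
qed

end

section \<open>Overlapping tuples: counting, second moments and concentration\<close>

lemma finite_distinct_tuples [simp]: "finite (distinct_tuples t n)"
  by (rule finite_subset[OF _ finite_lists_length_eq[of "{1..n}" t]]) (auto simp: distinct_tuples_def)

text \<open>Choose an enumeration of the support in at most \<open>n ^ u\<close> ways; each of the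
  \<open>L\<close> positions is then one of \<open>u \<le> L\<close> values. The crude factor
  \<open>L ^ L\<close> is independent of \<open>n\<close>.\<close>

lemma card_lists_with_support_le:
  "card {l. length l = L \<and> set l \<subseteq> {1..n} \<and> card (set l) = u} \<le> n ^ u * L ^ L"
proof (cases "u \<le> L")
  case False
  have e: "{l. length l = L \<and> set l \<subseteq> {1..n::nat} \<and> card (set l) = u} = {}"
    using False card_length[where 'a=nat] by auto
  show ?thesis unfolding e by simp
next
  case True
  let ?G = "{g. set g \<subseteq> {1..n} \<and> length g = u}"
  let ?B = "\<lambda>g. {l. set l \<subseteq> set g \<and> length l = L}"
  have sub: "{l. length l = L \<and> set l \<subseteq> {1..n} \<and> card (set l) = u} \<subseteq> (\<Union>g\<in>?G. ?B g)"
  proof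
    fix l assume l: "l \<in> {l. length l = L \<and> set l \<subseteq> {1..n} \<and> card (set l) = u}"
    obtain g where "set g = set l" "distinct g" using finite_distinct_list[of "set l"] by auto
    with l have "g \<in> ?G" "l \<in> ?B g" using distinct_card[of g] by auto
    then show "l \<in> (\<Union>g\<in>?G. ?B g)" by blast
  qed
  have fin: "finite ?G" by (intro finite_lists_length_eq) auto
  have "card {l. length l = L \<and> set l \<subseteq> {1..n} \<and> card (set l) = u} \<le> card (\<Union>g\<in>?G. ?B g)"
    using fin by (intro card_mono[OF _ sub] finite_UN_I finite_lists_length_eq) auto
  also have "\<dots> \<le> (\<Sum>g\<in>?G. card (?B g))" using fin by (rule card_UN_le)
  also have "\<dots> \<le> (\<Sum>g\<in>?G. L ^ L)"
  proof (rule sum_mono)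
    fix g assume "g \<in> ?G"
    then have "card (set g) \<le> L" using card_length[of g] True by auto
    then show "card (?B g) \<le> L ^ L"
      by (simp add: card_lists_length_eq power_mono)
  qed
  also have "\<dots> = n ^ u * L ^ L" by (simp add: card_lists_length_eq)
  finally show ?thesis .
qed

text \<open>Group the pairs by the size \<open>u\<close> of their union, which is at most
  \<open>2 * t - 1\<close> because of the overlap. Counting gives the factor
  \<open>(2 * t) ^ (2 * t)\<close>, and the number of possible \<open>u\<close> supplies the last
  factor \<open>2 * t\<close>.\<close>

lemma overlapping_pairs_sum_le:
  fixes q :: real
  assumes t: "1 \<le> t" and q: "0 < q" and nq: "1 \<le> real n * q"
  shows "(\<Sum>v\<in>distinct_tuples t n. \<Sum>w\<in>distinct_tuples t n.
            if set v \<inter> set w = {} then 0 else q ^ (card (set v \<union> set w) - 1))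
         \<le> real ((2 * t) ^ (2 * t + 1)) * (real n ^ (2 * t - 1) * q ^ (2 * t - 2))"
proof -
  let ?D = "distinct_tuples t n"
  define P where "P = {p \<in> ?D \<times> ?D. set (fst p) \<inter> set (snd p) \<noteq> {}}"
  let ?c = "\<lambda>p. card (set (fst p) \<union> set (snd p))"
  have finP: "finite P" by (simp add: P_def)
  have range: "?c ` P \<subseteq> {1..2 * t - 1}"
  proof clarify
    fix v w assume p: "(v, w) \<in> P"
    then have l: "card (set v) = t" "card (set w) = t" and i: "set v \<inter> set w \<noteq> {}"
      by (auto simp: P_def distinct_tuples_def distinct_card)
    have "card (set v \<inter> set w) > 0" using i by (simp add: card_gt_0_iff)
    moreover have "card (set v \<union> set w) + card (set v \<inter> set w) = 2 * t"
      using card_Un_Int[of "set v" "set w"] l by simp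
    moreover have "t \<le> card (set v \<union> set w)" unfolding l(1)[symmetric] by (intro card_mono) auto
    ultimately show "?c (v, w) \<in> {1..2 * t - 1}" using t by auto
  qed
  have cardu: "card {p\<in>P. ?c p = u} \<le> n ^ u * (2 * t) ^ (2 * t)" for u
  proof -
    have "card {p\<in>P. ?c p = u} \<le> card {l. length l = 2 * t \<and> set l \<subseteq> {1..n} \<and> card (set l) = u}"
    \<comment> \<open>A pair is encoded by its concatenation; both halves have length
      \<open>t\<close>, so the pair can be recovered.\<close>
    proof (rule card_inj_on_le[where f="\<lambda>p. fst p @ snd p"])
      show "inj_on (\<lambda>p. fst p @ snd p) {p\<in>P. ?c p = u}"
        by (auto simp: inj_on_def P_def distinct_tuples_def)
      show "finite {l. length l = 2 * t \<and> set l \<subseteq> {1..n} \<and> card (set l) = u}"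
        by (rule finite_subset[OF _ finite_lists_length_eq[of "{1..n}" "2*t"]]) auto
    qed (fastforce simp: P_def distinct_tuples_def)
    then show ?thesis using card_lists_with_support_le[of "2*t" n u] by linarith
  qed
  have "(\<Sum>v\<in>?D. \<Sum>w\<in>?D. if set v \<inter> set w = {} then 0 else q ^ (card (set v \<union> set w) - 1))
      = (\<Sum>p\<in>?D \<times> ?D. if set (fst p) \<inter> set (snd p) \<noteq> {} then q ^ (?c p - 1) else 0)"
    unfolding sum.cartesian_product by (rule sum.cong[OF refl]) (simp add: case_prod_beta)
  also have "\<dots> = (\<Sum>p\<in>P. q ^ (?c p - 1))"
    unfolding P_def by (intro sum.inter_filter[symmetric]) simp
  also have "\<dots> = (\<Sum>u\<in>{1..2 * t - 1}. \<Sum>p\<in>{p\<in>P. ?c p = u}. q ^ (?c p - 1))"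
    using range by (intro sum.group[symmetric] finP) auto
  also have "\<dots> = (\<Sum>u\<in>{1..2 * t - 1}. real (card {p\<in>P. ?c p = u}) * q ^ (u - 1))"
    by (intro sum.cong) auto
  also have "\<dots> \<le> (\<Sum>u\<in>{1..2 * t - 1}. real ((2 * t) ^ (2 * t)) * (real n ^ (2 * t - 1) * q ^ (2 * t - 2)))"
  proof (rule sum_mono)
    fix u assume u: "u \<in> {1..2 * t - 1}"
    have "real (card {p\<in>P. ?c p = u}) * q ^ (u - 1) \<le> real (n ^ u * (2 * t) ^ (2 * t)) * q ^ (u - 1)"
      using cardu[of u] q by (intro mult_right_mono) (auto simp del: of_nat_mult of_nat_power)
    also have "\<dots> = real ((2 * t) ^ (2 * t)) * (real n ^ u * q ^ (u - 1)) * 1" by simp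
    \<comment> \<open>Multiplying by a power of \<open>n * q\<close>, which is at least 1, raises
      every union size to the extreme case \<open>2 * t - 1\<close>.\<close>
    also have "\<dots> \<le> real ((2 * t) ^ (2 * t)) * (real n ^ u * q ^ (u - 1)) * (real n * q) ^ (2 * t - 1 - u)"
      using nq q by (intro mult_left_mono one_le_power) auto
    also have "\<dots> = real ((2 * t) ^ (2 * t)) * (real n ^ (u + (2 * t - 1 - u)) * q ^ ((u - 1) + (2 * t - 1 - u)))"
      by (simp only: power_add power_mult_distrib mult_ac)
    also have "u + (2 * t - 1 - u) = 2 * t - 1" using u by auto
    also have "(u - 1) + (2 * t - 1 - u) = 2 * t - 2" using u by auto
    finally show "real (card {p\<in>P. ?c p = u}) * q ^ (u - 1)
       \<le> real ((2 * t) ^ (2 * t)) * (real n ^ (2 * t - 1) * q ^ (2 * t - 2))" .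
  qed
  also have "\<dots> = real (2 * t - 1) * (real ((2 * t) ^ (2 * t)) * (real n ^ (2 * t - 1) * q ^ (2 * t - 2)))"
    by simp
  also have "\<dots> \<le> real (2 * t) * (real ((2 * t) ^ (2 * t)) * (real n ^ (2 * t - 1) * q ^ (2 * t - 2)))"
    using q by (intro mult_right_mono) auto
  also have "\<dots> = real ((2 * t) ^ (2 * t + 1)) * (real n ^ (2 * t - 1) * q ^ (2 * t - 2))"
    by simp
  finally show ?thesis .
qed

text \<open>Domination by the path weight is what feeds both the mean and the second-moment bounds,
  so paths and cycles can share one variance estimate. The weight \<open>h v\<close> may depend on
  the tuple and looks only at the coordinates in \<open>set v\<close>.\<close>

locale tuple_statistic = iid_kernel M F k q X "{1..n}"
  for M :: "'a measure" and F :: "'b measure" and k q X n +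
  fixes t :: nat and h :: "nat list \<Rightarrow> (nat \<Rightarrow> 'b) \<Rightarrow> real"
  assumes t_pos: "1 \<le> t"
    and meas_h: "\<And>v. v \<in> distinct_tuples t n \<Longrightarrow> h v \<in> borel_measurable (PiM (set v) (\<lambda>_. F))"
    and h_restrict: "\<And>v x. v \<in> distinct_tuples t n \<Longrightarrow> h v (restrict x (set v)) = h v x"
    and h_nonneg: "\<And>v x. v \<in> distinct_tuples t n \<Longrightarrow> 0 \<le> h v x"
    and h_le_path: "\<And>v x. v \<in> distinct_tuples t n \<Longrightarrow> h v x \<le> path_weight k x v"
begin

definition summand :: "nat list \<Rightarrow> 'a \<Rightarrow> real" where
  "summand v \<omega> = h v (\<lambda>i. X i \<omega>)"

definition stat :: "'a \<Rightarrow> real" where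
  "stat \<omega> = (\<Sum>v\<in>distinct_tuples t n. summand v \<omega>)"

lemma tupleD:
  assumes "v \<in> distinct_tuples t n"
  shows "set v \<subseteq> {1..n}" "card (set v) = t" "v \<noteq> []"
  using assms t_pos by (auto simp: distinct_tuples_def distinct_card)

lemma measurable_summand: "v \<in> distinct_tuples t n \<Longrightarrow> summand v \<in> borel_measurable M"
  unfolding summand_def
  by (rule measurable_restrict_sample[OF tupleD(1) meas_h]) (auto simp: h_restrict simp del: restrict_apply)

lemma measurable_stat [measurable]: "stat \<in> borel_measurable M"
  unfolding stat_def by (intro borel_measurable_sum measurable_summand)

lemma summand_range: "v \<in> distinct_tuples t n \<Longrightarrow> 0 \<le> summand v \<omega> \<and> summand v \<omega> \<le> 1"
  unfolding summand_def using h_nonneg h_le_path path_weight_range order_trans by blast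

lemma integrable_summand: "v \<in> distinct_tuples t n \<Longrightarrow> integrable M (summand v)"
  using summand_range measurable_summand by (intro integrable_const_bound[where B=1]) auto

lemma integrable_summand_mult:
  "v \<in> distinct_tuples t n \<Longrightarrow> w \<in> distinct_tuples t n \<Longrightarrow> integrable M (\<lambda>\<omega>. summand v \<omega> * summand w \<omega>)"
  using summand_range measurable_summand
  by (intro integrable_const_bound[where B=1]) (auto simp: abs_mult intro!: AE_I2 mult_le_one)

lemma expectation_summand_le:
  assumes v: "v \<in> distinct_tuples t n"
  shows "expectation (summand v) \<le> q ^ (t - 1)"
proof -
  obtain g where g: "tree_weight k (set v) g" "\<And>x. path_weight k x v \<le> g x"
    using tree_weight_of_path[OF tupleD(3)[OF v]] by blast
  have "expectation (summand v) \<le> expectation (\<lambda>\<omega>. g (\<lambda>i. X i \<omega>))"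
  proof (intro integral_mono integrable_summand[OF v])
    show "integrable M (\<lambda>\<omega>. g (\<lambda>i. X i \<omega>))"
      using tree_weight_range[OF g(1)] tupleD(1)[OF v]
      by (intro integrable_const_bound[where B=1] measurable_restrict_sample[OF _ measurable_tree_weight[OF g(1)]]
            tree_weight_restrict[OF g(1)]) auto
    show "summand v \<omega> \<le> g (\<lambda>i. X i \<omega>)" for \<omega>
      unfolding summand_def by (rule order_trans[OF h_le_path[OF v] g(2)])
  qed
  also have "\<dots> \<le> q ^ (t - 1)" using expectation_tree_le[OF g(1) tupleD(1)[OF v]] tupleD(2)[OF v] by simp
  finally show ?thesis .
qed

lemma expectation_summand_mult_le:
  assumes v: "v \<in> distinct_tuples t n" and w: "w \<in> distinct_tuples t n" and i: "set v \<inter> set w \<noteq> {}"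
  shows "expectation (\<lambda>\<omega>. summand v \<omega> * summand w \<omega>) \<le> q ^ (card (set v \<union> set w) - 1)"
proof -
  obtain g where g: "tree_weight k (set v \<union> set w) g" "\<And>x. path_weight k x v * path_weight k x w \<le> g x"
    using tree_weight_of_overlapping_paths[OF i] by blast
  have sub: "set v \<union> set w \<subseteq> {1..n}" using tupleD v w by auto
  have "expectation (\<lambda>\<omega>. summand v \<omega> * summand w \<omega>) \<le> expectation (\<lambda>\<omega>. g (\<lambda>i. X i \<omega>))"
  proof (intro integral_mono integrable_summand_mult[OF v w])
    show "integrable M (\<lambda>\<omega>. g (\<lambda>i. X i \<omega>))"
      using tree_weight_range[OF g(1)] sub
      by (intro integrable_const_bound[where B=1] measurable_restrict_sample[OF _ measurable_tree_weight[OF g(1)]]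
            tree_weight_restrict[OF g(1)]) auto
    show "summand v \<omega> * summand w \<omega> \<le> g (\<lambda>i. X i \<omega>)" for \<omega>
      unfolding summand_def
      by (rule order_trans[OF mult_mono[OF h_le_path[OF v] h_le_path[OF w]] g(2)])
         (use path_weight_range h_nonneg v w in auto)
  qed
  also have "\<dots> \<le> q ^ (card (set v \<union> set w) - 1)" by (rule expectation_tree_le[OF g(1) sub])
  finally show ?thesis .
qed

lemma expectation_summand_mult_disjoint:
  assumes v: "v \<in> distinct_tuples t n" and w: "w \<in> distinct_tuples t n" and i: "set v \<inter> set w = {}"
  shows "expectation (\<lambda>\<omega>. summand v \<omega> * summand w \<omega>) = expectation (summand v) * expectation (summand w)"
proof -
  have "indep_var (PiM (set v) (\<lambda>_. F)) (\<lambda>\<omega>. restrict (\<lambda>i. X i \<omega>) (set v))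
                  (PiM (set w) (\<lambda>_. F)) (\<lambda>\<omega>. restrict (\<lambda>i. X i \<omega>) (set w))"
    using indep_var_restrict[OF indep i tupleD(1)[OF v] tupleD(1)[OF w]] .
  from indep_var_compose[OF this meas_h[OF v] meas_h[OF w]]
  have "indep_var borel (summand v) borel (summand w)"
    by (simp add: comp_def h_restrict v w summand_def[abs_def] del: restrict_apply)
  then show ?thesis
    using integrable_summand v w by (intro indep_var_lebesgue_integral) auto
qed

lemma expectation_stat: "expectation stat = (\<Sum>v\<in>distinct_tuples t n. expectation (summand v))"
  unfolding stat_def by (intro Bochner_Integration.integral_sum integrable_summand)

lemma stat_sq: "(stat \<omega>)\<^sup>2 = (\<Sum>v\<in>distinct_tuples t n. \<Sum>w\<in>distinct_tuples t n. summand v \<omega> * summand w \<omega>)"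
  unfolding stat_def power2_eq_square sum_product ..

lemma integrable_stat: "integrable M stat"
  unfolding stat_def[abs_def] by (intro Bochner_Integration.integrable_sum integrable_summand)

lemma integrable_stat_sq: "integrable M (\<lambda>\<omega>. (stat \<omega>)\<^sup>2)"
  unfolding stat_sq by (intro Bochner_Integration.integrable_sum integrable_summand_mult)

text \<open>Disjoint tuples are independent and their covariances vanish. For overlapping tuples the
  product of the means is nonnegative, so dropping it leaves the mixed second moment, which the
  spanning tree bounds.\<close>

lemma variance_stat_le:
  assumes q: "0 < q" and nq: "1 \<le> real n * q"
  shows "variance stat \<le> real ((2 * t) ^ (2 * t + 1)) * (real n ^ (2 * t - 1) * q ^ (2 * t - 2))"
proof -
  let ?D = "distinct_tuples t n"
  have "variance stat = expectation (\<lambda>\<omega>. (stat \<omega>)\<^sup>2) - (expectation stat)\<^sup>2"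
    by (intro variance_eq integrable_stat integrable_stat_sq)
  also have "expectation (\<lambda>\<omega>. (stat \<omega>)\<^sup>2)
      = (\<Sum>v\<in>?D. \<Sum>w\<in>?D. expectation (\<lambda>\<omega>. summand v \<omega> * summand w \<omega>))"
    unfolding stat_sq
    by (simp add: Bochner_Integration.integral_sum Bochner_Integration.integrable_sum integrable_summand_mult)
  also have "(expectation stat)\<^sup>2 = (\<Sum>v\<in>?D. \<Sum>w\<in>?D. expectation (summand v) * expectation (summand w))"
    unfolding expectation_stat power2_eq_square sum_product ..
  also have "(\<Sum>v\<in>?D. \<Sum>w\<in>?D. expectation (\<lambda>\<omega>. summand v \<omega> * summand w \<omega>)) -
      (\<Sum>v\<in>?D. \<Sum>w\<in>?D. expectation (summand v) * expectation (summand w))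
     = (\<Sum>v\<in>?D. \<Sum>w\<in>?D. expectation (\<lambda>\<omega>. summand v \<omega> * summand w \<omega>)
          - expectation (summand v) * expectation (summand w))"
    by (simp add: sum_subtractf)
  also have "\<dots> \<le> (\<Sum>v\<in>?D. \<Sum>w\<in>?D.
            if set v \<inter> set w = {} then 0 else q ^ (card (set v \<union> set w) - 1))"
  proof (intro sum_mono)
    fix v w assume vw: "v \<in> ?D" "w \<in> ?D"
    have "0 \<le> expectation (summand v)" "0 \<le> expectation (summand w)"
      using summand_range vw by (auto intro!: Bochner_Integration.integral_nonneg)
    then have "0 \<le> expectation (summand v) * expectation (summand w)" by simp
    then show "expectation (\<lambda>\<omega>. summand v \<omega> * summand w \<omega>) - expectation (summand v) * expectation (summand w)
      \<le> (if set v \<inter> set w = {} then 0 else q ^ (card (set v \<union> set w) - 1))"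
      using expectation_summand_mult_le[OF vw] expectation_summand_mult_disjoint[OF vw]
      by (cases "set v \<inter> set w = {}") simp_all
  qed
  also have "\<dots> \<le> real ((2 * t) ^ (2 * t + 1)) * (real n ^ (2 * t - 1) * q ^ (2 * t - 2))"
    by (rule overlapping_pairs_sum_le[OF t_pos q nq])
  finally show ?thesis .
qed

text \<open>Chebyshev at the scale \<open>n ^ t * q ^ (t - 1)\<close>: its square exceeds the power
  in the variance bound by exactly one factor \<open>n\<close>.\<close>

lemma prob_stat_deviation_le:
  assumes q: "0 < q" and nq: "1 \<le> real n * q" and \<epsilon>: "0 < \<epsilon>"
  shows "prob {\<omega>\<in>space M. \<epsilon> \<le> \<bar>stat \<omega> / (real n ^ t * q ^ (t - 1)) - expectation stat / (real n ^ t * q ^ (t - 1))\<bar>}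
    \<le> real ((2 * t) ^ (2 * t + 1)) / (\<epsilon>\<^sup>2 * real n)"
proof -
  have n: "0 < real n" using nq by (cases n) auto
  let ?s = "real n ^ t * q ^ (t - 1)"
  have s: "?s > 0" using n q by simp
  have "{\<omega>\<in>space M. \<epsilon> \<le> \<bar>stat \<omega> / ?s - expectation stat / ?s\<bar>} = {\<omega>\<in>space M. \<epsilon> * ?s \<le> \<bar>stat \<omega> - expectation stat\<bar>}"
    using s by (auto simp: pos_le_divide_eq simp flip: diff_divide_distrib)
  also have "prob \<dots> \<le> variance stat / (\<epsilon> * ?s)\<^sup>2"
    using s \<epsilon> by (intro Chebyshev_inequality integrable_stat_sq) auto
  also have "\<dots> \<le> real ((2 * t) ^ (2 * t + 1)) * (real n ^ (2 * t - 1) * q ^ (2 * t - 2)) / (\<epsilon> * ?s)\<^sup>2"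
    by (intro divide_right_mono variance_stat_le q nq) auto
  also have "\<dots> = real ((2 * t) ^ (2 * t + 1)) / (\<epsilon>\<^sup>2 * real n)"
  proof -
    \<comment> \<open>Writing \<open>t\<close> as a successor turns the truncated subtractions in
      the exponents into genuine ones.\<close>
    obtain u where u: "t = Suc u" using t_pos by (cases t) auto
    have "(\<epsilon> * ?s)\<^sup>2 = \<epsilon>\<^sup>2 * real n * (real n ^ (2 * t - 1) * q ^ (2 * t - 2))"
      by (simp add: u power_mult_distrib power2_eq_square power_add mult_2 mult_2_right mult_ac)
    moreover have "real n ^ (2 * t - 1) * q ^ (2 * t - 2) \<noteq> 0" using n q by simp
    ultimately show ?thesis using \<epsilon> n by (simp del: of_nat_power)
  qed
  finally show ?thesis .
qed

end

lemma (in iid_kernel) path_tuple_statistic: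
  assumes "I = {1..n}" "1 \<le> t"
  shows "tuple_statistic M F k q X n t (\<lambda>v x. path_weight k x v)"
proof -
  interpret J: iid_kernel M F k q X "{1..n}" using iid_kernel_axioms assms(1) by simp
  show ?thesis
    by unfold_locales (use assms(2) path_weight_range in \<open>auto simp: measurable_path_weight path_weight_restrict\<close>)
qed

lemma (in iid_kernel) cycle_tuple_statistic:
  assumes "I = {1..n}" "1 \<le> t"
  shows "tuple_statistic M F k q X n t (\<lambda>v x. path_weight k x v * k (x (last v)) (x (hd v)))"
proof -
  interpret J: iid_kernel M F k q X "{1..n}" using iid_kernel_axioms assms(1) by simp
  show ?thesis
  proof unfold_locales
    fix v assume "v \<in> distinct_tuples t n"
    then have v: "last v \<in> set v" "hd v \<in> set v" using assms(2) by (auto simp: distinct_tuples_def intro!: last_in_set hd_in_set)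
    have [measurable]: "(\<lambda>x. x (last v)) \<in> measurable (PiM (set v) (\<lambda>_. F)) F"
      "(\<lambda>x. x (hd v)) \<in> measurable (PiM (set v) (\<lambda>_. F)) F"
      "(\<lambda>x. path_weight k x v) \<in> borel_measurable (PiM (set v) (\<lambda>_. F))"
      using v by (auto intro!: measurable_component_singleton measurable_path_weight)
    show "(\<lambda>x. path_weight k x v * k (x (last v)) (x (hd v))) \<in> borel_measurable (PiM (set v) (\<lambda>_. F))"
      by measurable
    fix x
    show "path_weight k (restrict x (set v)) v * k (restrict x (set v) (last v)) (restrict x (set v) (hd v)) =
         path_weight k x v * k (x (last v)) (x (hd v))"
      using v by (simp add: path_weight_restrict)
    show "0 \<le> path_weight k x v * k (x (last v)) (x (hd v))"
      using path_weight_range k_nonneg by simp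
    show "path_weight k x v * k (x (last v)) (x (hd v)) \<le> path_weight k x v"
      using path_weight_range k_nonneg k_le_1 by (intro mult_right_le_one_le) auto
  qed (rule assms)
qed

text \<open>The count is a falling factorial with \<open>t\<close> factors, all between
  \<open>n - t\<close> and \<open>n\<close>.\<close>

lemma card_distinct_tuples_limit: "(\<lambda>n. real (card (distinct_tuples t n)) / real n ^ t) \<longlonglongrightarrow> 1"
proof (rule tendsto_sandwich)
  have "(\<lambda>n. (1 - real t / real n) ^ t) \<longlonglongrightarrow> (1 - 0) ^ t"
    by (intro tendsto_intros lim_const_over_n)
  then show "(\<lambda>n. (1 - real t / real n) ^ t) \<longlonglongrightarrow> 1" by simp
  have card: "card (distinct_tuples t n) = \<Prod>{n - t + 1..n}" if "t \<le> n" for n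
    using card_lists_distinct_length_eq[of "{1..n}" t] that by (simp add: distinct_tuples_def)
  show "\<forall>\<^sub>F n in sequentially. (1 - real t / real n) ^ t \<le> real (card (distinct_tuples t n)) / real n ^ t"
    using eventually_ge_at_top[of "t + 1"]
  proof eventually_elim
    case (elim n)
    have "(\<Prod>i\<in>{n - t + 1..n}. n - t) \<le> \<Prod>{n - t + 1..n}" by (intro prod_mono) auto
    then have "(n - t) ^ t \<le> card (distinct_tuples t n)" using elim card[of n] by simp
    then have "(real n - real t) ^ t \<le> real (card (distinct_tuples t n))"
      using elim by (metis Suc_eq_plus1 Suc_leD of_nat_diff of_nat_le_iff of_nat_power)
    moreover have "1 - real t / real n = (real n - real t) / real n" using elim by (simp add: field_simps)
    ultimately show ?case by (simp add: power_divide divide_right_mono)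
  qed
  show "\<forall>\<^sub>F n in sequentially. real (card (distinct_tuples t n)) / real n ^ t \<le> 1"
    using eventually_ge_at_top[of "t + 1"]
  proof eventually_elim
    case (elim n)
    have "\<Prod>{n - t + 1..n} \<le> (\<Prod>i\<in>{n - t + 1..n}. n)" by (intro prod_mono) auto
    then have "card (distinct_tuples t n) \<le> n ^ t" using elim card[of n] by simp
    then have "real (card (distinct_tuples t n)) \<le> real n ^ t" by (metis of_nat_le_iff of_nat_power)
    then show ?case using elim by simp
  qed
qed auto

subsection \<open>The torus kernel at small radius\<close>

text \<open>The cutoff to the cube matters: for coordinates further than 1 apart, \<open>torus_dist\<close> is
  negative, so points far outside the cube would have unbounded neighbourhoods.\<close>
definition torus_kernel :: "real \<Rightarrow> real ^ 'm \<Rightarrow> real ^ 'm \<Rightarrow> real" where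
  "torus_kernel r y z = (if y \<in> cbox 0 1 \<and> z \<in> cbox 0 1 \<and> torus_dist y z \<le> r then 1 else 0)"

lemma torus_dist_le_iff: "torus_dist y z \<le> r \<longleftrightarrow> (\<forall>k. min \<bar>y $ k - z $ k\<bar> (1 - \<bar>y $ k - z $ k\<bar>) \<le> r)"
  unfolding torus_dist_def by (subst Max_le_iff) auto

lemma torus_kernel_commute: "torus_kernel r y z = torus_kernel r z y"
  unfolding torus_kernel_def torus_dist_le_iff by (simp add: abs_minus_commute conj_ac)

lemma torus_kernel_range: "0 \<le> torus_kernel r y z" "torus_kernel r y z \<le> 1"
  unfolding torus_kernel_def by auto

text \<open>Inside the cube the coordinate formula is the true distance on a circle of length 1, so
  the triangle inequality holds coordinatewise; the cutoff in the kernel supplies this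
  membership.\<close>

lemma torus_kernel_triangle:
  assumes "torus_kernel r x y = 1" "torus_kernel s x z = 1"
  shows "torus_kernel (r + s) y z = 1"
proof -
  have xyz: "x \<in> cbox 0 1" "y \<in> cbox 0 1" "z \<in> cbox 0 1" "torus_dist x y \<le> r" "torus_dist x z \<le> s"
    using assms unfolding torus_kernel_def by (auto split: if_splits)
  have "min \<bar>y $ k - z $ k\<bar> (1 - \<bar>y $ k - z $ k\<bar>) \<le> r + s" for k
  proof -
    have "min \<bar>x $ k - y $ k\<bar> (1 - \<bar>x $ k - y $ k\<bar>) \<le> r" "min \<bar>x $ k - z $ k\<bar> (1 - \<bar>x $ k - z $ k\<bar>) \<le> s"
      "0 \<le> x $ k" "x $ k \<le> 1" "0 \<le> y $ k" "y $ k \<le> 1" "0 \<le> z $ k" "z $ k \<le> 1"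
      using xyz by (auto simp: torus_dist_le_iff mem_box_cart)
    then show ?thesis unfolding min_le_iff_disj by arith
  qed
  then show ?thesis using xyz by (auto simp: torus_kernel_def torus_dist_le_iff)
qed

lemma measurable_torus_kernel:
  "(\<lambda>p. torus_kernel r (fst p) (snd p)) \<in> borel_measurable (borel \<Otimes>\<^sub>M borel)"
proof -
  have c [measurable]: "cbox 0 (1::real^'m) \<in> sets borel" by simp
  have i [measurable]: "(\<lambda>y::real^'m. y $ k) \<in> borel_measurable borel" for k
    by (intro borel_measurable_continuous_onI continuous_intros)
  have "Measurable.pred (borel \<Otimes>\<^sub>M borel) (\<lambda>p. \<forall>k\<in>UNIV. min \<bar>fst p $ k - snd p $ k\<bar> (1 - \<bar>fst p $ k - snd p $ k\<bar>) \<le> r)"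
    by (intro pred_intros_finite) measurable
  then have [measurable]: "Measurable.pred (borel \<Otimes>\<^sub>M borel) (\<lambda>p. torus_dist (fst p) (snd p) \<le> r)"
    by (simp add: torus_dist_le_iff)
  show ?thesis unfolding torus_kernel_def by measurable
qed

lemma measurable_torus_kernel_section: "torus_kernel r y \<in> borel_measurable borel"
  using measurable_compose[OF measurable_Pair1'[of y borel borel] measurable_torus_kernel[of r]] by simp

text \<open>Wrapping around shifts a coordinate by -1 or 1. Hence a torus ball about
  \<open>y\<close> is covered by the \<open>3^m\<close> translates of the cube of side
  \<open>2 * r\<close>, with no case distinction near the boundary.\<close>

lemma torus_kernel_le_boxes:
  fixes y z :: "real ^ 'm"
  shows "torus_kernel r y z \<le> (\<Sum>e\<in>PiE UNIV (\<lambda>_. {-1, 0, 1}).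
      indicator (cbox (\<chi> k. y $ k + e k - r) (\<chi> k. y $ k + e k + r)) z)"
proof (cases "y \<in> cbox 0 1 \<and> z \<in> cbox 0 1 \<and> torus_dist y z \<le> r")
  case True
  let ?E = "PiE (UNIV :: 'm set) (\<lambda>_. {-1, 0, 1::real})"
  have "\<exists>s\<in>{-1, 0, 1}. \<bar>y $ k + s - z $ k\<bar> \<le> r" for k
  proof -
    have "min \<bar>y $ k - z $ k\<bar> (1 - \<bar>y $ k - z $ k\<bar>) \<le> r" "0 \<le> y $ k" "y $ k \<le> 1" "0 \<le> z $ k" "z $ k \<le> 1"
      using True by (auto simp: torus_dist_le_iff mem_box_cart)
    then have "\<bar>y $ k - 1 - z $ k\<bar> \<le> r \<or> \<bar>y $ k - z $ k\<bar> \<le> r \<or> \<bar>y $ k + 1 - z $ k\<bar> \<le> r"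
      unfolding min_le_iff_disj by arith
    then show ?thesis by simp
  qed
  then obtain e where e: "\<And>k. e k \<in> {-1, 0, 1} \<and> \<bar>y $ k + e k - z $ k\<bar> \<le> r" by metis
  have mem: "z \<in> cbox (\<chi> k. y $ k + e k - r) (\<chi> k. y $ k + e k + r)"
  proof (unfold mem_box_cart, intro allI)
    fix k show "(\<chi> k. y $ k + e k - r) $ k \<le> z $ k \<and> z $ k \<le> (\<chi> k. y $ k + e k + r) $ k"
      using e[of k] by (simp add: abs_le_iff)
  qed
  have "torus_kernel r y z \<le> indicator (cbox (\<chi> k. y $ k + e k - r) (\<chi> k. y $ k + e k + r)) z"
    using mem torus_kernel_range by simp
  also have "\<dots> \<le> (\<Sum>e\<in>?E. indicator (cbox (\<chi> k. y $ k + e k - r) (\<chi> k. y $ k + e k + r)) z)"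
    using e by (intro member_le_sum finite_PiE) auto
  finally show ?thesis .
next
  case False
  then have "torus_kernel r y z = 0" by (auto simp: torus_kernel_def)
  then show ?thesis by (auto intro: sum_nonneg)
qed

lemma content_cube_cart:
  fixes c :: "'m::finite \<Rightarrow> real"
  assumes "0 \<le> r"
  shows "measure lborel (cbox (\<chi> k. c k - r) (\<chi> k. c k + r)) = (2 * r) ^ CARD('m)"
proof -
  have "cbox (\<chi> k. c k - r) (\<chi> k. c k + r) \<noteq> ({} :: (real^'m) set)"
    using assms by (auto simp: interval_ne_empty_cart)
  then show ?thesis by (simp add: content_cbox_cart)
qed

section \<open>Local averages for a continuous density on the cube\<close>

locale cube_density = F: prob_space F
  for F :: "(real ^ 'm) measure" +
  fixes f :: "real ^ 'm \<Rightarrow> real" and K :: real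
  assumes f_cont: "continuous_on (cbox 0 1) f"
    and f_nonneg: "\<And>x. x \<in> cbox 0 1 \<Longrightarrow> 0 \<le> f x"
    and f_le: "\<And>x. x \<in> cbox 0 1 \<Longrightarrow> f x \<le> K"
    and F_density: "F = density lborel (\<lambda>x. ennreal (indicator (cbox 0 1) x * f x))"
begin

text \<open>\<open>f\<close> is arbitrary outside the cube; its extension by zero is measurable,
  nonnegative and bounded everywhere.\<close>

definition dens :: "real ^ 'm \<Rightarrow> real" where
  "dens x = indicator (cbox 0 1) x * f x"

lemma F_eq: "F = density lborel (\<lambda>x. ennreal (dens x))"
  unfolding dens_def by (rule F_density)

lemma measurable_dens [measurable]: "dens \<in> borel_measurable borel"
  unfolding dens_def[abs_def] using borel_measurable_continuous_on_indicator[OF _ f_cont] by simp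

lemma K_nonneg: "0 \<le> K"
proof -
  have "(0::real^'m) \<in> cbox 0 1" by (simp add: mem_box_cart)
  from f_nonneg[OF this] f_le[OF this] show ?thesis by linarith
qed

lemma dens_range: "0 \<le> dens x" "dens x \<le> K"
  unfolding dens_def using f_nonneg f_le K_nonneg by (auto simp: indicator_def)

lemma sets_F [measurable_cong]: "sets F = sets borel" and space_F: "space F = UNIV"
  unfolding F_eq by auto

lemma integral_F: "g \<in> borel_measurable borel \<Longrightarrow> (\<integral>x. g x \<partial>F) = (\<integral>x. dens x * g x \<partial>lborel)"
  unfolding F_eq using dens_range by (subst integral_density) auto

text \<open>The faces of the cube are Lebesgue null. This allows the local limits, proved at
  interior points, to be integrated against \<open>F\<close>.\<close>

lemma AE_F: "AE x in F. x \<in> box 0 1"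
proof -
  have b: "box (0::real^'m) 1 \<subseteq> cbox 0 1" by (rule box_subset_cbox)
  have "emeasure lborel (cbox (0::real^'m) 1 - box 0 1) = emeasure lborel (cbox (0::real^'m) 1) - emeasure lborel (box (0::real^'m) 1)"
    using b by (intro emeasure_Diff) (auto simp: emeasure_lborel_box_eq)
  also have "\<dots> = 0" by (simp add: emeasure_lborel_cbox_eq emeasure_lborel_box_eq)
  finally have "cbox (0::real^'m) 1 - box 0 1 \<in> null_sets lborel" by auto
  from AE_not_in[OF this] have "AE x in lborel. 0 < dens x \<longrightarrow> x \<in> box (0::real^'m) 1"
    by eventually_elim (auto simp: dens_def indicator_def split: if_splits)
  then show ?thesis unfolding F_eq by (subst AE_density) auto
qed

lemma AE_F_cbox: "AE x in F. x \<in> cbox 0 1"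
  using AE_F box_subset_cbox by (auto elim!: eventually_mono)

text \<open>A bound for the density, times the number of translated cubes in
  \<open>torus_kernel_le_boxes\<close>, times the volume of each.\<close>

definition degree_bound :: "real \<Rightarrow> real" where
  "degree_bound r = K * 3 ^ CARD('m) * (2 * r) ^ CARD('m)"

lemma torus_kernel_integral_le:
  assumes r: "0 \<le> r"
  shows "(\<integral>z. torus_kernel r y z \<partial>F) \<le> degree_bound r"
proof -
  let ?E = "PiE (UNIV :: 'm set) (\<lambda>_. {-1, 0, 1::real})"
  let ?b = "\<lambda>e. cbox (\<chi> k. y $ k + e k - r) (\<chi> k. y $ k + e k + r)"
  have [measurable]: "torus_kernel r y \<in> borel_measurable borel"
    by (rule measurable_torus_kernel_section)
  have bi: "integrable lborel (indicator (?b e) :: _ \<Rightarrow> real)" for e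
    by (intro integrable_real_indicator) (auto simp: emeasure_lborel_cbox_eq)
  have "(\<integral>z. torus_kernel r y z \<partial>F) = (\<integral>z. dens z * torus_kernel r y z \<partial>lborel)"
    by (rule integral_F) simp
  also have "\<dots> \<le> (\<integral>z. K * (\<Sum>e\<in>?E. indicator (?b e) z) \<partial>lborel)"
  proof (rule integral_mono')
    show "integrable lborel (\<lambda>z. K * (\<Sum>e\<in>?E. indicator (?b e) z))"
      by (intro integrable_mult_right Bochner_Integration.integrable_sum bi)
    show "dens z * torus_kernel r y z \<le> K * (\<Sum>e\<in>?E. indicator (?b e) z)" for z
      using dens_range K_nonneg torus_kernel_range torus_kernel_le_boxes[of r y z] by (intro mult_mono) auto
    show "0 \<le> K * (\<Sum>e\<in>?E. indicator (?b e) z)" for z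
      by (intro mult_nonneg_nonneg K_nonneg sum_nonneg) auto
  qed
  also have "\<dots> = K * (\<Sum>e\<in>?E. measure lborel (?b e))"
    using bi by (simp add: Bochner_Integration.integral_sum)
  also have "\<dots> = K * (real (card ?E) * (2 * r) ^ CARD('m))"
    using content_cube_cart[OF r, of "\<lambda>k. y $ k + _ k"] by simp
  also have "card ?E = 3 ^ CARD('m)" by (simp add: card_PiE numeral_3_eq_3)
  also have "K * (real (3 ^ CARD('m)) * (2 * r) ^ CARD('m)) = degree_bound r"
    by (simp add: degree_bound_def)
  finally show ?thesis .
qed

lemma bounded_torus_kernel: "0 \<le> r \<Longrightarrow> bounded_kernel F (torus_kernel r) (degree_bound r)"
proof unfold_locales
  have "sets (F \<Otimes>\<^sub>M F) = sets (borel \<Otimes>\<^sub>M borel)" by (intro sets_pair_measure_cong sets_F)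
  then show "(\<lambda>z. torus_kernel r (fst z) (snd z)) \<in> borel_measurable (F \<Otimes>\<^sub>M F)"
    using measurable_torus_kernel by (subst measurable_cong_sets[OF _ refl]) auto
qed (auto simp: space_F torus_kernel_range torus_kernel_integral_le torus_kernel_commute)

text \<open>The limit is taken jointly in the radius and the point; pointwise convergence of \<open>G r\<close> would
  not survive averaging, so it could not be iterated.\<close>
lemma kernel_op_local_limit:
  assumes x: "x \<in> box 0 1"
    and G: "((\<lambda>(r, y). G r y) \<longlongrightarrow> L) (at_right 0 \<times>\<^sub>F nhds x)"
    and G_meas: "\<And>r. 0 < r \<Longrightarrow> G r \<in> borel_measurable borel"
  shows "((\<lambda>(r, y). kernel_op F (torus_kernel r) (G r) y / (2 * r) ^ CARD('m)) \<longlongrightarrow> L * f x) (at_right 0 \<times>\<^sub>F nhds x)"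
proof (rule tendstoI)
  fix \<epsilon> :: real assume \<epsilon>: "0 < \<epsilon>"
  have "isCont f x" using f_cont x by (intro continuous_on_interior[of "cbox 0 1"]) auto
  then have "(f \<longlongrightarrow> f x) (nhds x)"
    unfolding isCont_def tendsto_at_iff_tendsto_nhds .
  then have "((\<lambda>p. f (snd p)) \<longlongrightarrow> f x) (at_right (0::real) \<times>\<^sub>F nhds x)"
    using filterlim_snd by (rule filterlim_compose)
  from tendsto_mult[OF G this]
  have "((\<lambda>(r, y). G r y * f y) \<longlongrightarrow> L * f x) (at_right 0 \<times>\<^sub>F nhds x)"
    by (simp add: case_prod_unfold)
  from tendstoD[OF this, of "\<epsilon>/2"] \<epsilon>
  have "\<forall>\<^sub>F p in at_right 0 \<times>\<^sub>F nhds x. \<bar>G (fst p) (snd p) * f (snd p) - L * f x\<bar> < \<epsilon> / 2"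
    by (simp add: case_prod_beta dist_real_def)
  then obtain P Q where P: "eventually P (at_right 0)" and Q: "eventually Q (nhds x)"
    and PQ: "\<And>r y. P r \<Longrightarrow> Q y \<Longrightarrow> \<bar>G r y * f y - L * f x\<bar> < \<epsilon> / 2"
    unfolding eventually_prod_filter by auto
  obtain S where S: "open S" "x \<in> S" "\<And>y. y \<in> S \<Longrightarrow> Q y" using Q by (auto simp: eventually_nhds)
  have "open (S \<inter> box 0 1)" "x \<in> S \<inter> box 0 1" using S x by auto
  then obtain d where d: "0 < d" "ball x d \<subseteq> S \<inter> box 0 1" by (meson open_contains_ball)
  \<comment> \<open>The distance of a point of the box from its centre \<open>y\<close> is at most
    its l1 norm, hence at most \<open>m * r\<close>. So \<open>r < c\<close> keeps the box within
    \<open>d / 2\<close> of \<open>y\<close>, and within \<open>d\<close> of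
    \<open>x\<close>.\<close>
  define c where "c = d / (2 * real CARD('m))"
  have c: "0 < c" using d by (simp add: c_def)
  have E1: "eventually (\<lambda>r. P r \<and> 0 < r \<and> r < c) (at_right 0)"
    using P eventually_at_right_less[of "0::real"] c eventually_at_right_field[of "\<lambda>r. r < c" 0]
    by (auto intro!: eventually_conj)
  have E2: "eventually (\<lambda>y. dist y x < d / 2) (nhds x)"
    using d by (intro tendstoD[OF filterlim_ident]) auto
  have scale: "\<bar>a - b * w\<bar> \<le> e * w \<Longrightarrow> 0 < w \<Longrightarrow> \<bar>a / w - b\<bar> \<le> e" for a b w e :: real
    by (auto simp: field_simps abs_le_iff)
  have main: "dist (kernel_op F (torus_kernel r) (G r) y / (2 * r) ^ CARD('m)) (L * f x) < \<epsilon>"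
    if ry: "P r \<and> 0 < r \<and> r < c" and y: "dist y x < d / 2" for r y
  proof -
    from ry have Pr: "P r" and r: "0 < r" "r < c" by auto
    let ?v = "(2 * r) ^ CARD('m)"
    let ?B = "cbox (\<chi> k. y $ k - r) (\<chi> k. y $ k + r)"
    have v: "0 < ?v" using r by simp
    have near: "z \<in> S \<and> z \<in> box 0 1" if z: "z \<in> ?B" for z
    proof -
      have "norm (z - y) \<le> (\<Sum>k\<in>UNIV. \<bar>(z - y) $ k\<bar>)" by (rule norm_le_l1_cart)
      also have "\<dots> \<le> (\<Sum>k\<in>(UNIV::'m set). r)"
      proof (rule sum_mono)
        fix k
        have "y $ k - r \<le> z $ k" "z $ k \<le> y $ k + r" using z by (simp_all add: mem_box_cart)
        then show "\<bar>(z - y) $ k\<bar> \<le> r" by simp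
      qed
      also have "\<dots> = real CARD('m) * r" by simp
      also have "\<dots> < real CARD('m) * c" using r(2) by simp
      also have "\<dots> = d / 2" by (simp add: c_def)
      finally have "dist z y < d / 2" by (simp add: dist_norm)
      then have "dist x z < d" using y dist_triangle2[of x z y] by (simp add: dist_commute)
      then show ?thesis using d by auto
    qed
    \<comment> \<open>Testing \<open>near\<close> on two opposite corners shows that every
      coordinate of \<open>y\<close> stays more than \<open>r\<close> away from 0 and 1. There is
      then no wrap-around, and the kernel is the indicator of a single box.\<close>
    have "(\<chi> k. y $ k - r) \<in> ?B" "(\<chi> k. y $ k + r) \<in> ?B" "y \<in> ?B" using r by (auto simp: mem_box_cart)
    from this[THEN near] have yk: "0 < y $ k - r" "y $ k + r < 1" and yc: "y \<in> cbox 0 1" for k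
      by (auto simp: mem_box_cart less_imp_le)
    have kern: "dens z * torus_kernel r y z = indicator ?B z * dens z" for z
    proof (cases "z \<in> cbox 0 1")
      case True
      have "torus_dist y z \<le> r \<longleftrightarrow> z \<in> ?B"
      proof -
        have "min \<bar>y $ k - z $ k\<bar> (1 - \<bar>y $ k - z $ k\<bar>) \<le> r \<longleftrightarrow> y $ k - r \<le> z $ k \<and> z $ k \<le> y $ k + r" for k
        proof -
          have "0 \<le> z $ k" "z $ k \<le> 1" using True by (auto simp: mem_box_cart)
          then show ?thesis using yk[of k] unfolding min_le_iff_disj by arith
        qed
        then show ?thesis by (auto simp: torus_dist_le_iff mem_box_cart)
      qed
      then show ?thesis using True yc by (simp add: torus_kernel_def indicator_def)
    qed (simp add: dens_def)
    note [measurable] = G_meas[OF r(1)]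
    have Bi: "integrable lborel (\<lambda>z. indicator ?B z * (C::real))" for C
      by (intro integrable_mult_left integrable_real_indicator) (auto simp: emeasure_lborel_cbox_eq)
    have dG: "\<bar>indicator ?B z * (dens z * G r z - L * f x)\<bar> \<le> indicator ?B z * (\<epsilon> / 2)" for z
    proof (cases "z \<in> ?B")
      case True
      then have "dens z = f z" using near[OF True] box_subset_cbox[of "0::real^'m" 1] by (auto simp: dens_def)
      moreover have "\<bar>G r z * f z - L * f x\<bar> < \<epsilon> / 2" using PQ[OF Pr S(3)] near[OF True] by blast
      ultimately show ?thesis using True by (simp add: mult.commute)
    qed simp
    have i1: "integrable lborel (\<lambda>z. indicator ?B z * (dens z * G r z - L * f x))"
      by (rule Bochner_Integration.integrable_bound[OF Bi[of "\<epsilon> / 2"]]) (use order_trans[OF dG abs_ge_self] in \<open>auto simp del: abs_mult\<close>)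
    have i2: "integrable lborel (\<lambda>z. indicator ?B z * (dens z * G r z))"
      using Bochner_Integration.integrable_add[OF i1 Bi[of "L * f x"]] by (simp add: algebra_simps)
    have [measurable]: "torus_kernel r y \<in> borel_measurable borel"
      by (rule measurable_torus_kernel_section)
    have "kernel_op F (torus_kernel r) (G r) y = (\<integral>z. dens z * (torus_kernel r y z * G r z) \<partial>lborel)"
      unfolding kernel_op_def by (rule integral_F) simp
    also have "\<dots> = (\<integral>z. indicator ?B z * (dens z * G r z) \<partial>lborel)"
      by (simp only: kern flip: mult.assoc)
    finally have op: "kernel_op F (torus_kernel r) (G r) y = (\<integral>z. indicator ?B z * (dens z * G r z) \<partial>lborel)" .
    have vol: "(\<integral>z. indicator ?B z * C \<partial>lborel) = C * ?v" for C
      using content_cube_cart[of r "\<lambda>k. y $ k"] r by simp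
    have "(\<integral>z. indicator ?B z * (dens z * G r z - L * f x) \<partial>lborel)
        = (\<integral>z. indicator ?B z * (dens z * G r z) \<partial>lborel) - (\<integral>z. indicator ?B z * (L * f x) \<partial>lborel)"
      unfolding right_diff_distrib by (intro Bochner_Integration.integral_diff i2 Bi)
    also have "\<dots> = kernel_op F (torus_kernel r) (G r) y - L * f x * ?v" unfolding op vol ..
    finally have diff: "(\<integral>z. indicator ?B z * (dens z * G r z - L * f x) \<partial>lborel)
        = kernel_op F (torus_kernel r) (G r) y - L * f x * ?v" .
    have "\<bar>kernel_op F (torus_kernel r) (G r) y - L * f x * ?v\<bar>
        \<le> (\<integral>z. \<bar>indicator ?B z * (dens z * G r z - L * f x)\<bar> \<partial>lborel)"
      unfolding diff[symmetric] by (rule integral_abs_bound)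
    also have "\<dots> \<le> (\<integral>z. indicator ?B z * (\<epsilon> / 2) \<partial>lborel)"
      using dG by (intro integral_mono integrable_abs i1 Bi)
    also have "\<dots> = \<epsilon> / 2 * ?v" by (rule vol)
    finally have "\<bar>kernel_op F (torus_kernel r) (G r) y / ?v - L * f x\<bar> \<le> \<epsilon> / 2"
      using scale v by blast
    then show ?thesis
      using \<epsilon> by (simp add: dist_real_def)
  qed
  show "\<forall>\<^sub>F p in at_right 0 \<times>\<^sub>F nhds x.
      dist (case p of (r, y) \<Rightarrow> kernel_op F (torus_kernel r) (G r) y / (2 * r) ^ CARD('m)) (L * f x) < \<epsilon>"
    unfolding eventually_prod_filter prod.case using E1 E2 main by blast
qed

text \<open>Each of the \<open>j\<close> integrations runs over a torus ball which, away from the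
  boundary, is a cube of volume \<open>(2 * r)^m\<close>; dividing by these volumes gives a finite
  limit.\<close>

definition scaled_op :: "nat \<Rightarrow> real \<Rightarrow> real ^ 'm \<Rightarrow> real" where
  "scaled_op j r y = (kernel_op F (torus_kernel r) ^^ j) (\<lambda>_. 1) y / (2 * r) ^ (CARD('m) * j)"

lemma measurable_op_iterate:
  "0 \<le> r \<Longrightarrow> (kernel_op F (torus_kernel r) ^^ j) (\<lambda>_. 1) \<in> borel_measurable borel"
proof (induction j)
  case (Suc j)
  interpret bounded_kernel F "torus_kernel r" "degree_bound r" using Suc by (intro bounded_torus_kernel)
  have "(kernel_op F (torus_kernel r) ^^ j) (\<lambda>_. 1) \<in> borel_measurable F"
    using Suc by (subst measurable_cong_sets[OF sets_F refl]) auto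
  from measurable_op[OF this] show ?case by (simp add: measurable_cong_sets[OF sets_F refl])
qed auto

lemma measurable_scaled_op [measurable]: "0 < r \<Longrightarrow> scaled_op j r \<in> borel_measurable borel"
  unfolding scaled_op_def[abs_def] using measurable_op_iterate[of r j] by simp

lemma scaled_op_Suc: "scaled_op (Suc j) r y = kernel_op F (torus_kernel r) (scaled_op j r) y / (2 * r) ^ CARD('m)"
  by (simp add: scaled_op_def kernel_op_def power_add mult.commute)

lemma scaled_op_limit:
  assumes x: "x \<in> box 0 1"
  shows "((\<lambda>(r, y). scaled_op j r y) \<longlongrightarrow> f x ^ j) (at_right 0 \<times>\<^sub>F nhds x)"
proof (induction j)
  case 0
  then show ?case by (simp add: scaled_op_def case_prod_beta)
next
  case (Suc j)
  from kernel_op_local_limit[OF x Suc] show ?case by (simp add: scaled_op_Suc mult.commute)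
qed

text \<open>The bound is uniform in both the point and the radius, including points near the
  boundary, and serves as the dominating constant below.\<close>

lemma abs_scaled_op_le: "0 < r \<Longrightarrow> \<bar>scaled_op j r y\<bar> \<le> (K * 3 ^ CARD('m)) ^ j"
proof (induction j arbitrary: y)
  case (Suc j)
  interpret bounded_kernel F "torus_kernel r" "degree_bound r" using Suc by (intro bounded_torus_kernel) auto
  have "scaled_op j r \<in> borel_measurable F"
    using Suc by (subst measurable_cong_sets[OF sets_F refl]) auto
  then have "\<bar>op (scaled_op j r) y\<bar> \<le> (K * 3 ^ CARD('m)) ^ j * degree_bound r"
    using Suc by (intro abs_op_le) auto
  then have "\<bar>op (scaled_op j r) y\<bar> \<le> (K * 3 ^ CARD('m)) ^ Suc j * (2 * r) ^ CARD('m)"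
    by (simp only: degree_bound_def power_Suc2 mult.assoc)
  then show ?case
    using Suc.prems unfolding scaled_op_Suc abs_divide by (subst pos_divide_le_eq) simp_all
qed (simp add: scaled_op_def)

definition moment :: "nat \<Rightarrow> real" where
  "moment s = (LINT x:cbox 0 1|lborel. f x ^ s)"

text \<open>Integration against \<open>F\<close> contributes one further factor of the density,
  hence the shift of the exponent.\<close>

lemma integral_dens_power: "(\<integral>y. dens y ^ s \<partial>F) = moment (s + 1)"
proof -
  have "(\<integral>y. dens y ^ s \<partial>F) = (\<integral>y. dens y * dens y ^ s \<partial>lborel)"
    by (rule integral_F) simp
  also have "\<dots> = moment (s + 1)"
    unfolding moment_def set_lebesgue_integral_def
    by (intro Bochner_Integration.integral_cong) (auto simp: dens_def indicator_def)
  finally show ?thesis .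
qed

text \<open>The two exponents cover two shapes: \<open>p = 1\<close> is a path with \<open>j\<close>
  edges, \<open>j = 1\<close> is a star with \<open>p\<close> spokes. The limit follows by dominated
  convergence.\<close>

lemma integral_scaled_op_limit_all:
  assumes r: "filterlim r (at_right 0) sequentially" "\<And>n. 0 < r n"
  shows "(\<lambda>n. \<integral>y. scaled_op j (r n) y ^ p \<partial>F) \<longlonglongrightarrow> moment (j * p + 1)"
proof -
  have "(\<lambda>n. \<integral>y. scaled_op j (r n) y ^ p \<partial>F) \<longlonglongrightarrow> (\<integral>y. dens y ^ (j * p) \<partial>F)"
  proof (rule integral_dominated_convergence[where w="\<lambda>_. ((K * 3 ^ CARD('m)) ^ j) ^ p"])
    show "AE y in F. (\<lambda>n. scaled_op j (r n) y ^ p) \<longlonglongrightarrow> dens y ^ (j * p)"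
      using AE_F
    proof eventually_elim
      case (elim y)
      have "filterlim (\<lambda>n. (r n, y)) (at_right 0 \<times>\<^sub>F nhds y) sequentially"
        by (intro filterlim_Pair r tendsto_const)
      from filterlim_compose[OF scaled_op_limit[OF elim] this]
      have "(\<lambda>n. scaled_op j (r n) y) \<longlonglongrightarrow> f y ^ j" by simp
      then have "(\<lambda>n. scaled_op j (r n) y ^ p) \<longlonglongrightarrow> (f y ^ j) ^ p" by (rule tendsto_power)
      moreover have "dens y = f y" using elim box_subset_cbox[of 0 1] by (auto simp: dens_def)
      ultimately show ?case by (simp add: power_mult)
    qed
    show "AE y in F. norm (scaled_op j (r n) y ^ p) \<le> ((K * 3 ^ CARD('m)) ^ j) ^ p" for n
      using abs_scaled_op_le[OF r(2)] by (auto simp: power_abs intro!: AE_I2 power_mono)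
    show "(\<lambda>y. scaled_op j (r n) y ^ p) \<in> borel_measurable F" for n
      using measurable_scaled_op[OF r(2), of j n]
      by (subst measurable_cong_sets[OF sets_F refl]) (rule borel_measurable_power)
  qed auto
  also have "(\<integral>y. dens y ^ (j * p) \<partial>F) = moment (j * p + 1)"
    by (rule integral_dens_power)
  finally show ?thesis .
qed

lemma op_iterate_eq_scaled_op:
  "0 < s \<Longrightarrow> (kernel_op F (torus_kernel s) ^^ j) (\<lambda>_. 1) y = (2 * s) ^ (CARD('m) * j) * scaled_op j s y"
  by (simp add: scaled_op_def)

text \<open>Radii are positive only from index 1 on, so the sequence is shifted by one.\<close>

lemma integral_scaled_op_limit:
  assumes "filterlim s (at_right 0) sequentially" "\<And>n. 1 \<le> n \<Longrightarrow> 0 < s n"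
  shows "(\<lambda>n. \<integral>y. scaled_op j (s n) y ^ p \<partial>F) \<longlonglongrightarrow> moment (j * p + 1)"
proof -
  have "filterlim (\<lambda>n. s (Suc n)) (at_right 0) sequentially"
    by (rule filterlim_compose[OF assms(1) filterlim_Suc])
  then have "(\<lambda>n. \<integral>y. scaled_op j (s (Suc n)) y ^ p \<partial>F) \<longlonglongrightarrow> moment (j * p + 1)"
    using assms(2) by (intro integral_scaled_op_limit_all) auto
  then show ?thesis by (rule LIMSEQ_imp_Suc)
qed

section \<open>Moments of the density and the Cauchy--Schwarz defect\<close>

lemma set_integrable_f_power: "set_integrable lborel (cbox 0 1) (\<lambda>x. f x ^ s)"
  by (rule borel_integrable_compact[unfolded set_integrable_def[symmetric]]) (auto intro!: continuous_intros f_cont)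

lemma moment_1: "moment 1 = 1"
  using integral_dens_power[of 0] F.prob_space by simp

lemma box_01_nonempty: "box (0::real^'m) 1 \<noteq> {}"
  by (auto simp: interval_ne_empty_cart)

lemma set_integral_eq_0_iff:
  fixes g :: "real ^ 'm \<Rightarrow> real"
  assumes g: "continuous_on (cbox 0 1) g" "\<And>x. x \<in> cbox 0 1 \<Longrightarrow> 0 \<le> g x"
  shows "(LINT x:cbox 0 1|lborel. g x) = 0 \<longleftrightarrow> (\<forall>x\<in>cbox 0 1. g x = 0)"
proof -
  have "set_integrable lborel (cbox 0 1) g"
    by (rule borel_integrable_compact[unfolded set_integrable_def[symmetric]]) (auto intro: g)
  then show ?thesis
    using integral_cbox_eq_0_iff[OF g(1) box_01_nonempty g(2)] by (simp add: set_borel_integral_eq_integral)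
qed

text \<open>A vanishing moment would force the continuous nonnegative \<open>f\<close> to be 0 on
  the whole cube, contradicting total mass one.\<close>

lemma moment_pos: "0 < moment s"
proof -
  have "0 \<le> moment s"
    unfolding moment_def set_lebesgue_integral_def
    using f_nonneg by (intro Bochner_Integration.integral_nonneg) (auto simp: indicator_def)
  moreover have "moment s \<noteq> 0"
  proof
    assume "moment s = 0"
    then have "\<forall>x\<in>cbox 0 1. f x ^ s = 0"
      unfolding moment_def using f_nonneg
      by (subst (asm) set_integral_eq_0_iff) (auto intro!: continuous_intros f_cont)
    then have "\<forall>x\<in>cbox 0 1. f x = 0" by (cases "s = 0") auto
    then have "moment 1 = 0" unfolding moment_def
      using f_nonneg by (subst set_integral_eq_0_iff) (auto intro!: continuous_intros f_cont)
    with moment_1 show False by simp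
  qed
  ultimately show ?thesis by simp
qed

lemma Delta_eq: "Delta f = moment 4 * moment 2 - (moment 3)\<^sup>2"
  by (simp add: Delta_def moment_def)

lemma constant_density:
  assumes "\<And>x. x \<in> cbox 0 1 \<Longrightarrow> f x = c"
  shows "F = uniform_measure lborel (cbox 0 1)"
proof -
  have "(LINT x:cbox 0 1|lborel. f x ^ 1) = (LINT x:cbox (0::real^'m) 1|lborel. c)"
    using assms by (intro set_lebesgue_integral_cong) auto
  moreover have c1: "measure lborel (cbox (0::real^'m) 1) = 1"
    by (subst content_cbox_cart) (auto simp: interval_ne_empty_cart)
  moreover have e: "emeasure lborel (cbox (0::real^'m) 1) = 1"
    using c1 emeasure_lborel_cbox_finite[of "0::real^'m" 1] by (simp add: emeasure_eq_ennreal_measure less_top)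
  ultimately have "c = 1"
    using moment_1 by (simp add: moment_def set_lebesgue_integral_def)
  show ?thesis
    unfolding F_eq uniform_measure_def e
    by (rule density_cong, simp, simp) (use assms \<open>c = 1\<close> in \<open>auto simp: dens_def indicator_def\<close>)
qed

lemma Delta_pos:
  assumes "F \<noteq> uniform_measure lborel (cbox 0 1)"
  shows "0 < Delta f"
proof -
  \<comment> \<open>\<open>c\<close> is the coefficient of the orthogonal projection of
    \<open>f^2\<close> onto the line spanned by \<open>f\<close> in L2 of the cube. The squared norm
    of the residual is \<open>Delta f / moment 2\<close>.\<close>
  define c where "c = moment 3 / moment 2"
  let ?g = "\<lambda>x. (f x ^ 2 - c * f x)\<^sup>2"
  have "(LINT x:cbox 0 1|lborel. ?g x) = (LINT x:cbox 0 1|lborel. f x ^ 4 + (- 2 * c) * f x ^ 3 + c\<^sup>2 * f x ^ 2)"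
    by (simp add: power2_eq_square power4_eq_xxxx power3_eq_cube algebra_simps)
  also have "\<dots> = moment 4 + (- 2 * c) * moment 3 + c\<^sup>2 * moment 2"
    unfolding moment_def
    by (simp only: set_integral_add set_integrable_f_power set_integral_mult_right set_integrable_mult_right)
  also have "\<dots> = Delta f / moment 2"
    using moment_pos[of 2] unfolding Delta_eq c_def by (simp add: field_simps power2_eq_square)
  finally have g: "(LINT x:cbox 0 1|lborel. ?g x) = Delta f / moment 2" .
  have cont: "continuous_on (cbox 0 1) ?g" by (intro continuous_intros f_cont)
  have "0 \<le> (LINT x:cbox 0 1|lborel. ?g x)"
    unfolding set_lebesgue_integral_def by (intro Bochner_Integration.integral_nonneg) auto
  then have "0 \<le> Delta f" using moment_pos[of 2] by (simp add: g zero_le_divide_iff)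
  moreover have "Delta f \<noteq> 0"
  proof
    assume "Delta f = 0"
    then have "\<forall>x\<in>cbox 0 1. ?g x = 0"
      using set_integral_eq_0_iff[OF cont] g by simp
    then have v: "f x \<in> {0, c}" if "x \<in> cbox 0 1" for x
      using that by (auto simp: power2_eq_square)
    have "f constant_on cbox 0 1"
      by (rule continuous_finite_range_constant[OF _ f_cont finite_subset[of _ "{0, c}"]])
         (use v in \<open>auto intro: convex_connected\<close>)
    then obtain c' where "\<And>x. x \<in> cbox 0 1 \<Longrightarrow> f x = c'" by (auto simp: constant_on_def)
    from constant_density[OF this] assms show False by simp
  qed
  ultimately show ?thesis by simp
qed

end

subsection \<open>Convergence in probability as a filter\<close>

text \<open>Convergence along this filter is convergence in probability, which makes the limit calculus for
  filters available for random variables living on varying probability spaces.\<close>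
definition prob_filter :: "(nat \<Rightarrow> 'a measure) \<Rightarrow> (nat \<times> 'a) filter" where
  "prob_filter M = Abs_filter (\<lambda>P. \<exists>B. (\<forall>n\<ge>1. B n \<in> sets (M n)) \<and> (\<lambda>n. measure (M n) (B n)) \<longlonglongrightarrow> 0 \<and>
     (\<forall>n\<ge>1. \<forall>\<omega>\<in>space (M n) - B n. P (n, \<omega>)))"

lemma eventually_prob_filter:
  "eventually P (prob_filter M) \<longleftrightarrow>
    (\<exists>B. (\<forall>n\<ge>1. B n \<in> sets (M n)) \<and> (\<lambda>n. measure (M n) (B n)) \<longlonglongrightarrow> 0 \<and>
     (\<forall>n\<ge>1. \<forall>\<omega>\<in>space (M n) - B n. P (n, \<omega>)))"
  unfolding prob_filter_def
proof (rule eventually_Abs_filter, rule is_filter.intro)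
  show "\<exists>B. (\<forall>n\<ge>1. B n \<in> sets (M n)) \<and> (\<lambda>n. measure (M n) (B n)) \<longlonglongrightarrow> 0 \<and>
     (\<forall>n\<ge>1. \<forall>\<omega>\<in>space (M n) - B n. True)"
    by (intro exI[of _ "\<lambda>_. {}"]) auto
next
  fix P Q :: "nat \<times> 'a \<Rightarrow> bool"
  assume "\<exists>B. (\<forall>n\<ge>1. B n \<in> sets (M n)) \<and> (\<lambda>n. measure (M n) (B n)) \<longlonglongrightarrow> 0 \<and>
     (\<forall>n\<ge>1. \<forall>\<omega>\<in>space (M n) - B n. P (n, \<omega>))"
    "\<exists>B. (\<forall>n\<ge>1. B n \<in> sets (M n)) \<and> (\<lambda>n. measure (M n) (B n)) \<longlonglongrightarrow> 0 \<and>
     (\<forall>n\<ge>1. \<forall>\<omega>\<in>space (M n) - B n. Q (n, \<omega>))"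
  then obtain B C where BC: "\<forall>n\<ge>1. B n \<in> sets (M n)" "(\<lambda>n. measure (M n) (B n)) \<longlonglongrightarrow> 0"
    "\<forall>n\<ge>1. \<forall>\<omega>\<in>space (M n) - B n. P (n, \<omega>)" "\<forall>n\<ge>1. C n \<in> sets (M n)"
    "(\<lambda>n. measure (M n) (C n)) \<longlonglongrightarrow> 0" "\<forall>n\<ge>1. \<forall>\<omega>\<in>space (M n) - C n. Q (n, \<omega>)" by blast
  have "(\<lambda>n. measure (M n) (B n \<union> C n)) \<longlonglongrightarrow> 0"
  proof (rule tendsto_sandwich[OF _ _ tendsto_const])
    show "(\<lambda>n. measure (M n) (B n) + measure (M n) (C n)) \<longlonglongrightarrow> 0"
      using tendsto_add[OF BC(2,5)] by simp
    show "\<forall>\<^sub>F n in sequentially. measure (M n) (B n \<union> C n) \<le> measure (M n) (B n) + measure (M n) (C n)"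
      by (rule eventually_mono[OF eventually_ge_at_top[of 1]]) (use BC(1,4) in \<open>auto intro: measure_Un_le\<close>)
  qed auto
  then show "\<exists>B. (\<forall>n\<ge>1. B n \<in> sets (M n)) \<and> (\<lambda>n. measure (M n) (B n)) \<longlonglongrightarrow> 0 \<and>
     (\<forall>n\<ge>1. \<forall>\<omega>\<in>space (M n) - B n. P (n, \<omega>) \<and> Q (n, \<omega>))"
    using BC by (intro exI[of _ "\<lambda>n. B n \<union> C n"]) auto
next
  fix P Q :: "nat \<times> 'a \<Rightarrow> bool"
  assume PQ: "\<forall>x. P x \<longrightarrow> Q x" and "\<exists>B. (\<forall>n\<ge>1. B n \<in> sets (M n)) \<and> (\<lambda>n. measure (M n) (B n)) \<longlonglongrightarrow> 0 \<and>
     (\<forall>n\<ge>1. \<forall>\<omega>\<in>space (M n) - B n. P (n, \<omega>))"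
  then obtain B where "\<forall>n\<ge>1. B n \<in> sets (M n)" "(\<lambda>n. measure (M n) (B n)) \<longlonglongrightarrow> 0"
     "\<forall>n\<ge>1. \<forall>\<omega>\<in>space (M n) - B n. P (n, \<omega>)" by blast
  with PQ show "\<exists>B. (\<forall>n\<ge>1. B n \<in> sets (M n)) \<and> (\<lambda>n. measure (M n) (B n)) \<longlonglongrightarrow> 0 \<and>
     (\<forall>n\<ge>1. \<forall>\<omega>\<in>space (M n) - B n. Q (n, \<omega>))" by (intro exI[of _ B]) auto
qed

text \<open>Taking the whole space as exceptional event at the finitely many bad \<open>n\<close>
  transfers deterministic limits to this filter.\<close>

lemma filterlim_fst_prob_filter: "filterlim fst sequentially (prob_filter M)"
  unfolding filterlim_iff
proof (intro allI impI)
  fix P :: "nat \<Rightarrow> bool" assume P: "eventually P sequentially"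
  have "(\<lambda>n. measure (M n) (if P n then {} else space (M n))) \<longlonglongrightarrow> 0"
    by (rule tendsto_eventually) (use P in \<open>auto elim!: eventually_mono\<close>)
  then show "\<forall>\<^sub>F x in prob_filter M. P (fst x)"
    unfolding eventually_prob_filter
    by (intro exI[of _ "\<lambda>n. if P n then {} else space (M n)"]) auto
qed

text \<open>Almost sure identities may be used as if they were pointwise; this lets the adjacency
  matrix be exchanged for the kernel cut off to the cube.\<close>

lemma eventually_prob_filter_AE:
  assumes "\<And>n. 1 \<le> n \<Longrightarrow> AE \<omega> in M n. P (n, \<omega>)"
  shows "eventually P (prob_filter M)"
proof -
  have "\<forall>n\<in>{1..}. \<exists>B. B \<in> null_sets (M n) \<and> {\<omega>\<in>space (M n). \<not> P (n, \<omega>)} \<subseteq> B"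
    using assms by (auto simp: eventually_ae_filter)
  from bchoice[OF this] obtain B where
    B: "\<And>n. 1 \<le> n \<Longrightarrow> B n \<in> null_sets (M n) \<and> {\<omega>\<in>space (M n). \<not> P (n, \<omega>)} \<subseteq> B n" by auto
  have "(\<lambda>n. measure (M n) (B n)) \<longlonglongrightarrow> 0"
    by (intro tendsto_eventually eventually_mono[OF eventually_ge_at_top[of 1]])
       (use B in \<open>auto simp: null_sets_def measure_def\<close>)
  with B show ?thesis unfolding eventually_prob_filter by (intro exI[of _ B]) (auto simp: null_sets_def)
qed

lemma tendsto_prob_filter:
  assumes meas: "\<And>n. 1 \<le> n \<Longrightarrow> Z n \<in> borel_measurable (M n)"
    and lim: "\<And>\<epsilon>. 0 < \<epsilon> \<Longrightarrow> (\<lambda>n. measure (M n) {\<omega>\<in>space (M n). \<epsilon> \<le> \<bar>Z n \<omega>\<bar>}) \<longlonglongrightarrow> 0"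
  shows "((\<lambda>(n, \<omega>). Z n \<omega>) \<longlongrightarrow> (0::real)) (prob_filter M)"
proof (rule tendstoI)
  fix \<epsilon> :: real assume "0 < \<epsilon>"
  from lim[OF this] meas show "\<forall>\<^sub>F x in prob_filter M. dist (case x of (n, \<omega>) \<Rightarrow> Z n \<omega>) 0 < \<epsilon>"
    unfolding eventually_prob_filter
    by (intro exI[of _ "\<lambda>n. {\<omega>\<in>space (M n). \<epsilon> \<le> \<bar>Z n \<omega>\<bar>}"]) auto
qed

text \<open>The way back from the filter: the tail event at level \<epsilon> lies inside the
  exceptional event that the limit provides at that level.\<close>

lemma o_P_one_prob_filter:
  assumes meas: "\<And>n. 1 \<le> n \<Longrightarrow> e n \<in> borel_measurable (M n)"
    and prob: "\<And>n. 1 \<le> n \<Longrightarrow> prob_space (M n)"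
    and lim: "((\<lambda>(n, \<omega>). e n \<omega>) \<longlongrightarrow> 0) (prob_filter M)"
  shows "o_P_one M e"
  unfolding o_P_one_def
proof (intro conjI allI impI)
  fix \<epsilon> :: real assume "0 < \<epsilon>"
  from tendstoD[OF lim this] obtain B where B: "\<forall>n\<ge>1. B n \<in> sets (M n)" "(\<lambda>n. measure (M n) (B n)) \<longlonglongrightarrow> 0"
    "\<forall>n\<ge>1. \<forall>\<omega>\<in>space (M n) - B n. \<bar>e n \<omega>\<bar> < \<epsilon>" unfolding eventually_prob_filter by auto
  show "(\<lambda>n. measure (M n) {\<omega>\<in>space (M n). \<epsilon> < \<bar>e n \<omega>\<bar>}) \<longlonglongrightarrow> 0"
  proof (rule tendsto_sandwich[OF _ _ tendsto_const B(2)])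
    show "\<forall>\<^sub>F n in sequentially. measure (M n) {\<omega>\<in>space (M n). \<epsilon> < \<bar>e n \<omega>\<bar>} \<le> measure (M n) (B n)"
      using eventually_ge_at_top[of 1]
    proof eventually_elim
      case (elim n)
      interpret prob_space "M n" using elim by (rule prob)
      have "\<omega> \<in> B n" if "\<omega> \<in> space (M n)" "\<epsilon> < \<bar>e n \<omega>\<bar>" for \<omega>
        using B(3) elim that by (meson DiffI less_asym)
      then show ?case using B(1) elim by (intro finite_measure_mono) auto
    qed
  qed auto
qed (use meas in auto)

subsection \<open>Counts in the random geometric graph\<close>

lemma path_weight_eq_1:
  "(\<And>b c. b \<in> set v \<Longrightarrow> c \<in> set v \<Longrightarrow> k (x b) (x c) = 1) \<Longrightarrow> path_weight k x v = 1"
  by (induction k x v rule: path_weight.induct) auto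

lemma prod_list_torus_kernel:
  "(\<Prod>b\<leftarrow>l. torus_kernel r y (x b)) = (if \<forall>b\<in>set l. torus_kernel r y (x b) = 1 then 1 else 0)"
  by (induction l) (auto simp: torus_kernel_def)

text \<open>Only the order of magnitude of the expected number of 6-cycles is needed, and stars of half
  the radius give the lower bound.\<close>
lemma star_le_cycle:
  assumes "l \<noteq> []" "0 \<le> r"
  shows "(\<Prod>b\<leftarrow>l. torus_kernel (r / 2) (x a) (x b))
    \<le> path_weight (torus_kernel r) x (a # l) * torus_kernel r (x (last (a # l))) (x a)"
proof (cases "\<forall>b\<in>set l. torus_kernel (r / 2) (x a) (x b) = 1")
  case True
  \<comment> \<open>The centre must count as its own neighbour. It lies in the cube because some
    spoke has weight 1, and such a spoke exists as \<open>l\<close> is nonempty.\<close>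
  have "x a \<in> cbox 0 1" using True assms(1) by (cases l) (auto simp: torus_kernel_def split: if_splits)
  moreover have "torus_dist (x a) (x a) \<le> r / 2"
    unfolding torus_dist_le_iff using assms(2) by simp
  ultimately have "torus_kernel (r / 2) (x a) (x a) = 1"
    by (simp add: torus_kernel_def)
  with True have *: "\<forall>b\<in>set (a # l). torus_kernel (r / 2) (x a) (x b) = 1" by simp
  have **: "torus_kernel r (x b) (x c) = 1" if "b \<in> set (a # l)" "c \<in> set (a # l)" for b c
    using torus_kernel_triangle[of "r / 2" "x a" "x b" "r / 2" "x c"] * that by auto
  have "last (a # l) \<in> set (a # l)" by (rule last_in_set) simp
  then have "torus_kernel r (x (last (a # l))) (x a) = 1" by (intro **) auto
  moreover have "path_weight (torus_kernel r) x (a # l) = 1" by (rule path_weight_eq_1) (rule **)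
  ultimately show ?thesis using True by (simp add: prod_list_torus_kernel)
next
  case False
  have "0 \<le> path_weight (torus_kernel r) x w" for w
    by (induction w rule: induct_list012) (auto simp: torus_kernel_range)
  then show ?thesis using False torus_kernel_range by (auto simp: prod_list_torus_kernel)
qed

text \<open>Each count is written as its scale times a normalised value \<open>z\<close>. All powers
  of \<open>n\<close> and \<open>q\<close> cancel against the deterministic factor, leaving a
  product in which every factor is expected to tend to 1.\<close>

lemma ratio_identity:
  fixes n q \<mu> c2 D z2 z3 z4 z6 :: real
  assumes "1 < n" "0 < q" "0 < \<mu>" "0 < c2" "D \<noteq> 0" "0 < z2" "0 < z6"
  shows "sqrt 2 * ((n ^ 4 * q ^ 3 * z4) * (n ^ 2 * q * z2) - (n ^ 3 * q ^ 2 * z3)\<^sup>2) /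
      (n ^ 5 * (1 / (n * (n - 1)) * (n ^ 2 * q * z2)) * sqrt (4 * (n ^ 6 * q ^ 5 * z6) / n ^ 6)) /
      (sqrt 2 * D * n * sqrt q / (2 * c2 * sqrt \<mu>))
    = (z4 * z2 - z3\<^sup>2) / D * (c2 / z2) * ((n - 1) / n) * sqrt (\<mu> / z6)"
proof -
  \<comment> \<open>Naming the square roots and substituting \<open>q = s ^ 2\<close> makes the
    identity purely rational.\<close>
  define s u w b where suwb: "s = sqrt q" "u = sqrt z6" "w = sqrt \<mu>" "b = sqrt (2::real)"
  have pos: "0 < s" "0 < u" "0 < w" "0 < b" using assms by (auto simp: suwb)
  have q: "q = s ^ 2" using assms by (simp add: suwb)
  have "sqrt (4 * (n ^ 6 * q ^ 5 * z6) / n ^ 6) = sqrt ((2 * q ^ 2) ^ 2 * q * z6)"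
    using assms by (intro arg_cong[where f=sqrt]) (simp add: field_simps flip: power_Suc power_add power_mult)
  also have "\<dots> = 2 * q ^ 2 * s * u" using assms by (simp only: real_sqrt_mult real_sqrt_abs suwb) simp
  finally have r: "sqrt (4 * (n ^ 6 * q ^ 5 * z6) / n ^ 6) = 2 * q ^ 2 * s * u" .
  have p: "(n ^ 4 * q ^ 3 * z4) * (n ^ 2 * q * z2) - (n ^ 3 * q ^ 2 * z3)\<^sup>2 = n ^ 6 * q ^ 4 * (z4 * z2 - z3\<^sup>2)"
    by (simp add: algebra_simps power2_eq_square power3_eq_cube power4_eq_xxxx eval_nat_numeral)
  have main: "b * (n ^ 6 * q ^ 4 * N) / (n ^ 5 * (1 / (n * (n - 1)) * (n ^ 2 * q * z2)) * (2 * q ^ 2 * s * u)) /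
      (b * D * n * s / (2 * c2 * w)) = N / D * (c2 / z2) * ((n - 1) / n) * (w / u)" for N
    unfolding q using assms pos by (simp add: divide_simps) (simp add: algebra_simps eval_nat_numeral)
  have w_u: "w / u = sqrt (\<mu> / z6)" by (simp add: suwb real_sqrt_divide)
  show ?thesis unfolding r p using main[of "z4 * z2 - z3\<^sup>2"] unfolding w_u unfolding suwb .
qed

lemma distinct_tuples_nth: "v \<in> distinct_tuples t n \<Longrightarrow> i < t \<Longrightarrow> v ! i \<in> {1..n}"
  using nth_mem[of i v] unfolding distinct_tuples_def by blast

lemma rgg_adj_eq_torus_kernel:
  "i \<noteq> j \<Longrightarrow> x i \<in> cbox 0 1 \<Longrightarrow> x j \<in> cbox 0 1 \<Longrightarrow> rgg_adj r x i j = torus_kernel r (x i) (x j)"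
  by (simp add: rgg_adj_def torus_kernel_def)

section \<open>Asymptotics of the counts along the sequence of graphs\<close>

locale rgg_sequence = cube_density F f K
  for F :: "(real ^ 'm) measure" and f and K +
  fixes M :: "nat \<Rightarrow> 'a measure" and X :: "nat \<Rightarrow> nat \<Rightarrow> 'a \<Rightarrow> real ^ 'm" and r :: "nat \<Rightarrow> real"
  assumes K_pos: "0 < K"
    and prob_M: "\<And>n. 1 \<le> n \<Longrightarrow> prob_space (M n)"
    and indep_X: "\<And>n. 1 \<le> n \<Longrightarrow> prob_space.indep_vars (M n) (\<lambda>_. borel) (X n) {1..n}"
    and distr_X: "\<And>n i. 1 \<le> n \<Longrightarrow> i \<in> {1..n} \<Longrightarrow> distr (M n) borel (X n i) = F"
    and r_pos: "\<And>n. 1 \<le> n \<Longrightarrow> 0 < r n"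
    and r_lim: "filterlim r (at_right 0) sequentially"
    and dense: "filterlim (\<lambda>n. real n * r n ^ CARD('m)) at_top sequentially"
begin

abbreviation kern :: "nat \<Rightarrow> real ^ 'm \<Rightarrow> real ^ 'm \<Rightarrow> real" where
  "kern n \<equiv> torus_kernel (r n)"

definition q :: "nat \<Rightarrow> real" where
  "q n = degree_bound (r n)"

text \<open>The constant ratio of the bound \<open>q n\<close> to the volume
  \<open>(2 * r n)^m\<close>; each edge costs one such factor when passing between the two
  normalisations.\<close>

definition \<kappa> :: real where
  "\<kappa> = K * 3 ^ CARD('m)"

lemma \<kappa>_pos: "0 < \<kappa>"
  using K_pos by (simp add: \<kappa>_def)

lemma q_eq: "q n = \<kappa> * (2 * r n) ^ CARD('m)"
  by (simp add: q_def degree_bound_def \<kappa>_def)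

lemma q_pos: "1 \<le> n \<Longrightarrow> 0 < q n"
  using r_pos \<kappa>_pos by (simp add: q_eq)

text \<open>Here \<open>n r^m\<close> tending to infinity enters the variance bound.\<close>

lemma eventually_nq: "\<forall>\<^sub>F n in sequentially. 1 \<le> real n * q n"
proof -
  have "\<forall>\<^sub>F n in sequentially. 1 / (\<kappa> * 2 ^ CARD('m)) \<le> real n * r n ^ CARD('m)"
    using dense by (auto simp: filterlim_at_top)
  then show ?thesis
    by eventually_elim (use \<kappa>_pos in \<open>simp add: q_eq field_simps power_mult_distrib\<close>)
qed

text \<open>The radius \<open>s\<close> is free because the lower bound for cycles needs the same
  sample with half the radius.\<close>

lemma iid:
  assumes n: "1 \<le> n" and s: "0 < s"
  shows "iid_kernel (M n) F (torus_kernel s) (degree_bound s) (X n) {1..n}"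
proof -
  interpret prob_space "M n" using n by (rule prob_M)
  interpret bounded_kernel F "torus_kernel s" "degree_bound s" using s by (intro bounded_torus_kernel) simp
  have "indep_vars (\<lambda>_. F) (X n) {1..n}"
    using indep_X[OF n] unfolding indep_vars_def2 sets_F by (simp add: measurable_cong_sets[OF refl sets_F])
  moreover have "distr (M n) F (X n i) = F" if "i \<in> {1..n}" for i
    using distr_cong[OF refl sets_F, of "M n" "X n i" "X n i"] distr_X[OF n that] by simp
  ultimately show ?thesis by unfold_locales
qed

lemma iid_kern: "1 \<le> n \<Longrightarrow> iid_kernel (M n) F (kern n) (q n) (X n) {1..n}"
  unfolding q_def using r_pos by (intro iid)

text \<open>Chebyshev leaves a probability of order \<open>1 / n\<close>. The centring is by the
  mean at each \<open>n\<close>, so that it also applies to cycles, whose mean is only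
  bounded.\<close>

lemma tuple_statistic_limit:
  assumes ts: "\<And>n. 1 \<le> n \<Longrightarrow> tuple_statistic (M n) F (kern n) (q n) (X n) n t (h n)"
  defines "S \<equiv> \<lambda>n \<omega>. \<Sum>v\<in>distinct_tuples t n. h n v (\<lambda>i. X n i \<omega>)"
  shows "((\<lambda>(n, \<omega>). S n \<omega> / (real n ^ t * q n ^ (t - 1)) - (\<integral>\<omega>. S n \<omega> \<partial>M n) / (real n ^ t * q n ^ (t - 1))) \<longlongrightarrow> 0)
    (prob_filter M)"
proof -
  have stat: "tuple_statistic.stat (X n) n t (h n) = S n" if "1 \<le> n" for n
  proof -
    interpret tuple_statistic "M n" F "kern n" "q n" "X n" n t "h n" using that by (rule ts)
    show ?thesis unfolding stat_def[abs_def] summand_def S_def ..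
  qed
  show ?thesis
  proof (rule tendsto_prob_filter)
    fix n :: nat assume n: "1 \<le> n"
    interpret tuple_statistic "M n" F "kern n" "q n" "X n" n t "h n" using n by (rule ts)
    have [measurable]: "S n \<in> borel_measurable (M n)" using measurable_stat stat[OF n] by simp
    show "(\<lambda>\<omega>. S n \<omega> / (real n ^ t * q n ^ (t - 1)) - (\<integral>\<omega>. S n \<omega> \<partial>M n) / (real n ^ t * q n ^ (t - 1)))
        \<in> borel_measurable (M n)" by measurable
  next
    fix \<epsilon> :: real assume \<epsilon>: "0 < \<epsilon>"
    show "(\<lambda>n. measure (M n) {\<omega>\<in>space (M n). \<epsilon> \<le>
        \<bar>S n \<omega> / (real n ^ t * q n ^ (t - 1)) - (\<integral>\<omega>. S n \<omega> \<partial>M n) / (real n ^ t * q n ^ (t - 1))\<bar>}) \<longlonglongrightarrow> 0"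
    proof (rule tendsto_sandwich[OF _ _ tendsto_const])
      have "(\<lambda>n. (real ((2 * t) ^ (2 * t + 1)) / \<epsilon>\<^sup>2) / real n) \<longlonglongrightarrow> 0" by (rule lim_const_over_n)
      then show "(\<lambda>n. real ((2 * t) ^ (2 * t + 1)) / (\<epsilon>\<^sup>2 * real n)) \<longlonglongrightarrow> 0" by simp
      show "\<forall>\<^sub>F n in sequentially. measure (M n) {\<omega>\<in>space (M n). \<epsilon> \<le>
          \<bar>S n \<omega> / (real n ^ t * q n ^ (t - 1)) - (\<integral>\<omega>. S n \<omega> \<partial>M n) / (real n ^ t * q n ^ (t - 1))\<bar>}
        \<le> real ((2 * t) ^ (2 * t + 1)) / (\<epsilon>\<^sup>2 * real n)"
        using eventually_nq eventually_ge_at_top[of 1]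
      proof eventually_elim
        case (elim n)
        interpret tuple_statistic "M n" F "kern n" "q n" "X n" n t "h n" using elim by (intro ts)
        show ?case using prob_stat_deviation_le[OF q_pos elim(1) \<epsilon>] elim by (simp only: stat[OF elim(2)])
      qed
    qed auto
  qed
qed

definition path_count :: "nat \<Rightarrow> nat \<Rightarrow> 'a \<Rightarrow> real" where
  "path_count t n \<omega> = (\<Sum>v\<in>distinct_tuples t n. path_weight (kern n) (\<lambda>i. X n i \<omega>) v)"

definition cycle_count :: "nat \<Rightarrow> 'a \<Rightarrow> real" where
  "cycle_count n \<omega> = (\<Sum>v\<in>distinct_tuples 6 n.
     path_weight (kern n) (\<lambda>i. X n i \<omega>) v * kern n (X n (last v) \<omega>) (X n (hd v) \<omega>))"

definition cycle_mean :: "nat \<Rightarrow> real" where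
  "cycle_mean n = (\<integral>\<omega>. cycle_count n \<omega> \<partial>M n) / (real n ^ 6 * q n ^ 5)"

text \<open>All tuples have the same mean, and each of the \<open>t - 1\<close> edges contributes
  \<open>(2 * r n)^m / q n = 1 / \<kappa>\<close>. The exponent \<open>^ 1\<close> matches the case
  \<open>p = 1\<close> of \<open>integral_scaled_op_limit\<close>.\<close>

lemma path_count_mean:
  assumes n: "1 \<le> n" and t: "1 \<le> t"
  shows "(\<integral>\<omega>. path_count t n \<omega> \<partial>M n) / (real n ^ t * q n ^ (t - 1))
    = real (card (distinct_tuples t n)) / real n ^ t * (\<integral>y. scaled_op (t - 1) (r n) y ^ 1 \<partial>F) / \<kappa> ^ (t - 1)"
proof -
  interpret iid_kernel "M n" F "kern n" "q n" "X n" "{1..n}" using n by (rule iid_kern)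
  interpret S: tuple_statistic "M n" F "kern n" "q n" "X n" n t "\<lambda>v x. path_weight (kern n) x v"
    using t by (intro path_tuple_statistic) simp
  have "expectation (S.summand v) = (2 * r n) ^ (CARD('m) * (t - 1)) * (\<integral>y. scaled_op (t - 1) (r n) y \<partial>F)"
    if v: "v \<in> distinct_tuples t n" for v
  proof -
    have "expectation (\<lambda>\<omega>. path_weight (kern n) (\<lambda>i. X n i \<omega>) v * 1) = (\<integral>y. (op ^^ (length v - 1)) (\<lambda>_. 1) y \<partial>F)"
      using v t by (intro expectation_path[where h="\<lambda>_. 1" and C=1]) (auto simp: distinct_tuples_def)
    then show ?thesis
      using v r_pos[OF n] by (simp add: S.summand_def[abs_def] distinct_tuples_def op_iterate_eq_scaled_op)
  qed
  then have "expectation S.stat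
      = real (card (distinct_tuples t n)) * ((2 * r n) ^ (CARD('m) * (t - 1)) * (\<integral>y. scaled_op (t - 1) (r n) y \<partial>F))"
    by (simp add: S.expectation_stat)
  moreover have "S.stat = path_count t n" unfolding S.stat_def[abs_def] S.summand_def path_count_def[abs_def] ..
  ultimately show ?thesis
    using r_pos[OF n] n by (simp add: q_eq power_mult_distrib power_mult)
qed

lemma path_count_limit:
  assumes t: "1 \<le> t"
  shows "((\<lambda>(n, \<omega>). path_count t n \<omega> / (real n ^ t * q n ^ (t - 1))) \<longlongrightarrow> moment t / \<kappa> ^ (t - 1)) (prob_filter M)"
proof -
  let ?m = "\<lambda>n. (\<integral>\<omega>. path_count t n \<omega> \<partial>M n) / (real n ^ t * q n ^ (t - 1))"
  have 1: "((\<lambda>(n, \<omega>). path_count t n \<omega> / (real n ^ t * q n ^ (t - 1)) - ?m n) \<longlongrightarrow> 0) (prob_filter M)"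
    unfolding path_count_def
  proof (rule tuple_statistic_limit)
    fix n :: nat assume n: "1 \<le> n"
    interpret iid_kernel "M n" F "kern n" "q n" "X n" "{1..n}" using n by (rule iid_kern)
    show "tuple_statistic (M n) F (kern n) (q n) (X n) n t (\<lambda>v x. path_weight (kern n) x v)"
      using t by (intro path_tuple_statistic) simp
  qed
  have "(\<lambda>n. real (card (distinct_tuples t n)) / real n ^ t * (\<integral>y. scaled_op (t - 1) (r n) y ^ 1 \<partial>F) / \<kappa> ^ (t - 1))
      \<longlonglongrightarrow> 1 * moment ((t - 1) * 1 + 1) / \<kappa> ^ (t - 1)"
    using \<kappa>_pos r_lim r_pos by (intro tendsto_intros card_distinct_tuples_limit integral_scaled_op_limit) auto
  then have lim: "(\<lambda>n. real (card (distinct_tuples t n)) / real n ^ t * (\<integral>y. scaled_op (t - 1) (r n) y ^ 1 \<partial>F) / \<kappa> ^ (t - 1))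
      \<longlonglongrightarrow> moment t / \<kappa> ^ (t - 1)"
    using t by (simp only: mult_1 mult_1_right le_add_diff_inverse2)
  have "?m \<longlonglongrightarrow> moment t / \<kappa> ^ (t - 1)"
    by (rule Lim_transform_eventually[OF lim eventually_mono[OF eventually_ge_at_top[of 1]]])
       (rule path_count_mean[OF _ t, symmetric])
  from tendsto_add[OF 1 filterlim_compose[OF this filterlim_fst_prob_filter]]
  show ?thesis by (simp add: case_prod_unfold)
qed

text \<open>From above, a 6-cycle is dominated by a path with 5 edges. From below, it is at least a
  star of half the radius with 5 spokes, whose mean converges to a positive moment after
  scaling.\<close>

lemma cycle_mean_bounds:
  "\<exists>\<gamma>>0. \<forall>\<^sub>F n in sequentially. \<gamma> \<le> cycle_mean n \<and> cycle_mean n \<le> 2"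
proof -
  \<comment> \<open>The limit of the star bound: 5 spokes produce \<open>moment 6\<close>, and each
    costs \<open>(r n)^m / q n = 1 / (\<kappa> * 2^m)\<close>.\<close>
  define \<gamma> where "\<gamma> = moment 6 / (\<kappa> * 2 ^ CARD('m)) ^ 5"
  have \<gamma>: "0 < \<gamma>" using moment_pos \<kappa>_pos by (simp add: \<gamma>_def)
  let ?c = "\<lambda>n. real (card (distinct_tuples 6 n)) / real n ^ 6"
  let ?I = "\<lambda>n. \<integral>y. scaled_op 1 (r n / 2) y ^ 5 \<partial>F"
  have bounds: "?c n * ?I n / (\<kappa> * 2 ^ CARD('m)) ^ 5 \<le> cycle_mean n \<and> cycle_mean n \<le> ?c n" if n: "1 \<le> n" for n
  proof -
    interpret iid_kernel "M n" F "kern n" "q n" "X n" "{1..n}" using n by (rule iid_kern)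
    interpret H: iid_kernel "M n" F "torus_kernel (r n / 2)" "degree_bound (r n / 2)" "X n" "{1..n}"
      using n r_pos[OF n] by (intro iid) auto
    interpret S: tuple_statistic "M n" F "kern n" "q n" "X n" n 6
      "\<lambda>v x. path_weight (kern n) x v * kern n (x (last v)) (x (hd v))"
      by (intro cycle_tuple_statistic) simp_all
    have lower: "r n ^ (CARD('m) * 5) * ?I n \<le> expectation (S.summand v)" if v: "v \<in> distinct_tuples 6 n" for v
    proof -
      from v obtain a l where al: "v = a # l" "length l = 5"
        by (cases v) (auto simp: distinct_tuples_def)
      have sub: "set l \<subseteq> {1..n}" "distinct l" "a \<in> {1..n}" "a \<notin> set l"
        using v by (auto simp: distinct_tuples_def al)
      have "expectation (\<lambda>\<omega>. 1 * (\<Prod>b\<leftarrow>l. torus_kernel (r n / 2) (X n a \<omega>) (X n b \<omega>)))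
          = (\<integral>y. 1 * H.op (\<lambda>_. 1) y ^ length l \<partial>F)"
        by (rule H.expectation_star[where B=1]) (use sub in auto)
      \<comment> \<open>At radius \<open>r n / 2\<close> the cube has side \<open>r n\<close>, so
        the scaling factor per spoke is \<open>(r n)^m\<close>.\<close>
      also have "\<dots> = (\<integral>y. r n ^ (CARD('m) * 5) * scaled_op 1 (r n / 2) y ^ 5 \<partial>F)"
        using op_iterate_eq_scaled_op[of "r n / 2" 1] r_pos[OF n] al
        by (simp add: power_mult_distrib power_mult)
      also have "\<dots> = r n ^ (CARD('m) * 5) * ?I n" by simp
      finally have star: "expectation (\<lambda>\<omega>. \<Prod>b\<leftarrow>l. torus_kernel (r n / 2) (X n a \<omega>) (X n b \<omega>)) = r n ^ (CARD('m) * 5) * ?I n"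
        by simp
      have "expectation (\<lambda>\<omega>. \<Prod>b\<leftarrow>l. torus_kernel (r n / 2) (X n a \<omega>) (X n b \<omega>)) \<le> expectation (S.summand v)"
      proof (rule integral_mono'[OF S.integrable_summand[OF v]])
        show "(\<Prod>b\<leftarrow>l. torus_kernel (r n / 2) (X n a \<omega>) (X n b \<omega>)) \<le> S.summand v \<omega>" for \<omega>
          using star_le_cycle[of l "r n" "\<lambda>i. X n i \<omega>" a] al r_pos[OF n] by (auto simp: S.summand_def)
        show "0 \<le> S.summand v \<omega>" for \<omega> using S.summand_range[OF v] by simp
      qed
      with star show ?thesis by simp
    qed
    have upper: "expectation (S.summand v) \<le> q n ^ 5" if "v \<in> distinct_tuples 6 n" for v
      using S.expectation_summand_le[OF that] by simp
    have E: "expectation (cycle_count n) = (\<Sum>v\<in>distinct_tuples 6 n. expectation (S.summand v))"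
      unfolding S.expectation_stat[symmetric] S.stat_def[abs_def] S.summand_def cycle_count_def[abs_def] ..
    have lo: "real (card (distinct_tuples 6 n)) * (r n ^ (CARD('m) * 5) * ?I n) \<le> expectation (cycle_count n)"
      unfolding E by (rule sum_bounded_below[OF lower])
    have up: "expectation (cycle_count n) \<le> real (card (distinct_tuples 6 n)) * q n ^ 5"
      unfolding E by (rule sum_bounded_above[OF upper])
    have pos: "0 \<le> real n ^ 6 * q n ^ 5" using q_pos[OF n] by simp
    note b = divide_right_mono[OF lo pos, folded cycle_mean_def] divide_right_mono[OF up pos, folded cycle_mean_def]
    have "real (card (distinct_tuples 6 n)) * (r n ^ (CARD('m) * 5) * ?I n) / (real n ^ 6 * q n ^ 5)
        = ?c n * ?I n / (\<kappa> * 2 ^ CARD('m)) ^ 5"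
      using r_pos[OF n] by (simp add: q_eq power_mult_distrib power_mult)
    moreover have "real (card (distinct_tuples 6 n)) * q n ^ 5 / (real n ^ 6 * q n ^ 5) = ?c n"
      using q_pos[OF n] by simp
    ultimately show ?thesis using b by simp
  qed
  have half: "filterlim (\<lambda>n. r n / 2) (at_right 0) sequentially"
  proof -
    have "(\<lambda>n. r n / 2) \<longlonglongrightarrow> 0 / 2" using r_lim by (intro tendsto_intros) (auto simp: filterlim_at)
    moreover have "\<forall>\<^sub>F n in sequentially. 0 < r n / 2"
      by (rule eventually_mono[OF eventually_ge_at_top[of 1]]) (use r_pos in auto)
    ultimately show ?thesis by (auto simp: filterlim_at elim: eventually_mono)
  qed
  have "(\<lambda>n. ?c n * ?I n / (\<kappa> * 2 ^ CARD('m)) ^ 5) \<longlonglongrightarrow> 1 * moment (1 * 5 + 1) / (\<kappa> * 2 ^ CARD('m)) ^ 5"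
    using \<kappa>_pos half r_pos by (intro tendsto_intros card_distinct_tuples_limit integral_scaled_op_limit) auto
  then have "(\<lambda>n. ?c n * ?I n / (\<kappa> * 2 ^ CARD('m)) ^ 5) \<longlonglongrightarrow> \<gamma>" by (simp add: \<gamma>_def)
  then have "\<forall>\<^sub>F n in sequentially. \<gamma> / 2 < ?c n * ?I n / (\<kappa> * 2 ^ CARD('m)) ^ 5"
    using \<gamma> by (intro order_tendstoD) auto
  moreover have "\<forall>\<^sub>F n in sequentially. ?c n < 2"
    using card_distinct_tuples_limit[of 6] by (intro order_tendstoD) auto
  ultimately have "\<forall>\<^sub>F n in sequentially. \<gamma> / 2 \<le> cycle_mean n \<and> cycle_mean n \<le> 2"
    using eventually_ge_at_top[of 1]
  proof eventually_elim
    case (elim n)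
    with bounds[of n] show ?case by linarith
  qed
  with \<gamma> show ?thesis by (intro exI[of _ "\<gamma> / 2"]) auto
qed

text \<open>Since \<open>cycle_mean\<close> stays above a positive constant, convergence of the
  difference to 0 becomes convergence of the quotient to 1.\<close>

lemma cycle_count_limit:
  "((\<lambda>(n, \<omega>). cycle_count n \<omega> / (real n ^ 6 * q n ^ 5) / cycle_mean n) \<longlongrightarrow> 1) (prob_filter M)"
proof -
  have "((\<lambda>(n, \<omega>). cycle_count n \<omega> / (real n ^ 6 * q n ^ (6 - 1)) - (\<integral>\<omega>. cycle_count n \<omega> \<partial>M n) / (real n ^ 6 * q n ^ (6 - 1))) \<longlongrightarrow> 0) (prob_filter M)"
    unfolding cycle_count_def
  proof (rule tuple_statistic_limit)
    fix n :: nat assume n: "1 \<le> n"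
    interpret iid_kernel "M n" F "kern n" "q n" "X n" "{1..n}" using n by (rule iid_kern)
    show "tuple_statistic (M n) F (kern n) (q n) (X n) n 6
        (\<lambda>v x. path_weight (kern n) x v * kern n (x (last v)) (x (hd v)))"
      by (intro cycle_tuple_statistic) simp_all
  qed
  then have 1: "((\<lambda>p. cycle_count (fst p) (snd p) / (real (fst p) ^ 6 * q (fst p) ^ 5) - cycle_mean (fst p)) \<longlongrightarrow> 0) (prob_filter M)"
    by (simp add: case_prod_unfold cycle_mean_def)
  obtain \<gamma> where \<gamma>: "0 < \<gamma>" "\<forall>\<^sub>F n in sequentially. \<gamma> \<le> cycle_mean n \<and> cycle_mean n \<le> 2"
    using cycle_mean_bounds by blast
  have ev: "\<forall>\<^sub>F p in prob_filter M. \<gamma> \<le> cycle_mean (fst p)"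
    using filterlim_fst_prob_filter[of M] \<gamma>(2) unfolding filterlim_iff by (auto elim: eventually_mono)
  have "((\<lambda>p. cycle_count (fst p) (snd p) / (real (fst p) ^ 6 * q (fst p) ^ 5) / cycle_mean (fst p) - 1) \<longlongrightarrow> 0) (prob_filter M)"
  proof (rule Lim_null_comparison[where g="\<lambda>p. \<bar>cycle_count (fst p) (snd p) / (real (fst p) ^ 6 * q (fst p) ^ 5) - cycle_mean (fst p)\<bar> / \<gamma>"])
    show "((\<lambda>p. \<bar>cycle_count (fst p) (snd p) / (real (fst p) ^ 6 * q (fst p) ^ 5) - cycle_mean (fst p)\<bar> / \<gamma>) \<longlongrightarrow> 0) (prob_filter M)"
      using tendsto_divide[OF tendsto_rabs[OF 1] tendsto_const[of \<gamma>]] \<gamma>(1) by simp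
    show "\<forall>\<^sub>F p in prob_filter M. norm (cycle_count (fst p) (snd p) / (real (fst p) ^ 6 * q (fst p) ^ 5) / cycle_mean (fst p) - 1)
        \<le> \<bar>cycle_count (fst p) (snd p) / (real (fst p) ^ 6 * q (fst p) ^ 5) - cycle_mean (fst p)\<bar> / \<gamma>"
      using ev
    proof eventually_elim
      case (elim p)
      have gen: "\<bar>z / m - 1\<bar> \<le> \<bar>z - m\<bar> / \<gamma>" if "\<gamma> \<le> m" for z m :: real
      proof -
        have "z / m - 1 = (z - m) / m" using that \<gamma>(1) by (simp add: field_simps)
        then have "\<bar>z / m - 1\<bar> = \<bar>z - m\<bar> / m" using that \<gamma>(1) by simp
        also have "\<dots> \<le> \<bar>z - m\<bar> / \<gamma>" using that \<gamma>(1) by (intro divide_left_mono) auto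
        finally show ?thesis .
      qed
      show ?case unfolding real_norm_def by (rule gen[OF elim])
    qed
  qed
  then show ?thesis unfolding case_prod_unfold by (rule LIM_zero_cancel)
qed

text \<open>The statistic of the theorem with the adjacency indicators replaced by the kernel cut
  off to the cube; the two agree almost surely.\<close>

definition count_ratio :: "nat \<Rightarrow> 'a \<Rightarrow> real" where
  "count_ratio n \<omega> = sqrt 2 * (path_count 4 n \<omega> * path_count 2 n \<omega> - (path_count 3 n \<omega>)\<^sup>2) /
     (real n ^ 5 * (1 / (real n * (real n - 1)) * path_count 2 n \<omega>) * sqrt (4 * cycle_count n \<omega> / real n ^ 6))"

lemma count_ratio_limit:
  assumes "0 < Delta f"
  shows "\<exists>a. (\<forall>n\<ge>1. a n \<noteq> 0) \<and> a \<in> \<Theta>(\<lambda>n. sqrt (real n) * sqrt (real n * r n ^ CARD('m)) * Delta f) \<and>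
     ((\<lambda>(n, \<omega>). count_ratio n \<omega> / a n) \<longlongrightarrow> 1) (prob_filter M)"
proof -
  obtain \<gamma> where \<gamma>: "0 < \<gamma>" "\<forall>\<^sub>F n in sequentially. \<gamma> \<le> cycle_mean n \<and> cycle_mean n \<le> 2"
    using cycle_mean_bounds by blast
  define c where "c t = moment t / \<kappa> ^ (t - 1)" for t
  have c2: "0 < c 2" using moment_pos \<kappa>_pos by (simp add: c_def)
  \<comment> \<open>The limit of the normalised \<open>T_stat\<close>. Both terms carry the same
    power of \<open>\<kappa>\<close>, so it is \<open>Delta f\<close> divided by
    \<open>\<kappa> ^ 4\<close>.\<close>
  define D where "D = c 4 * c 2 - (c 3)\<^sup>2"
  have "D = Delta f / \<kappa> ^ 4"
    unfolding D_def c_def Delta_eq using \<kappa>_pos by (simp add: field_simps flip: power_mult power_add power_Suc)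
  then have D: "0 < D" using assms \<kappa>_pos by simp
  \<comment> \<open>The deterministic factor is normalised by \<open>cycle_mean\<close> itself, which is only known up to constants; the junk branch keeps \<open>a n\<close> nonzero for small \<open>n\<close>.\<close>
  define a where "a n = (if 0 < cycle_mean n then sqrt 2 * D * real n * sqrt (q n) / (2 * c 2 * sqrt (cycle_mean n)) else 1)" for n
  have a_nz: "a n \<noteq> 0" if "1 \<le> n" for n
    using that D c2 q_pos[OF that] by (auto simp: a_def)
  have a_Theta: "a \<in> \<Theta>(\<lambda>n. sqrt (real n) * sqrt (real n * r n ^ CARD('m)) * Delta f)"
  proof -
    let ?b = "\<lambda>n. sqrt (real n) * sqrt (real n * r n ^ CARD('m)) * Delta f"
    \<comment> \<open>Chosen so that \<open>a n = C / sqrt (cycle_mean n) * ?b n\<close>; the bounds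
      for \<open>cycle_mean\<close> then yield both constants of the \<open>\<Theta>\<close>
      estimate.\<close>
    define C where "C = sqrt 2 * D * sqrt (\<kappa> * 2 ^ CARD('m)) / (2 * c 2 * Delta f)"
    have C: "0 < C" using D c2 assms \<kappa>_pos by (simp add: C_def)
    have eq: "a n = C / sqrt (cycle_mean n) * ?b n" if "1 \<le> n" "0 < cycle_mean n" for n
    proof -
      have "sqrt (q n) = sqrt (\<kappa> * 2 ^ CARD('m)) * sqrt (r n ^ CARD('m))"
        by (simp add: q_eq power_mult_distrib real_sqrt_mult)
      moreover have "sqrt (real n) * sqrt (real n * r n ^ CARD('m)) = real n * sqrt (r n ^ CARD('m))"
        by (simp add: real_sqrt_mult)
      ultimately show ?thesis using that assms by (simp add: a_def C_def mult_ac)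
    qed
    have b_nonneg: "0 \<le> ?b n" if "1 \<le> n" for n
      using assms r_pos[OF that] by simp
    have "\<forall>\<^sub>F n in sequentially. C / sqrt 2 * ?b n \<le> a n \<and> a n \<le> C / sqrt \<gamma> * ?b n"
      using \<gamma>(2) eventually_ge_at_top[of 1]
    proof eventually_elim
      case (elim n)
      have m: "0 < cycle_mean n" using elim \<gamma>(1) by linarith
      have le: "C / sqrt 2 \<le> C / sqrt (cycle_mean n)" "C / sqrt (cycle_mean n) \<le> C / sqrt \<gamma>"
        using C m \<gamma>(1) elim by (auto intro!: divide_left_mono)
      show ?case unfolding eq[OF elim(2) m] by (intro conjI mult_right_mono le b_nonneg elim(2))
    qed
    then have ev: "\<forall>\<^sub>F n in sequentially. C / sqrt 2 * norm (?b n) \<le> norm (a n) \<and> norm (a n) \<le> C / sqrt \<gamma> * norm (?b n)"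
      using eventually_ge_at_top[of 1]
    proof eventually_elim
      case (elim n)
      have b: "0 \<le> ?b n" using elim(2) by (rule b_nonneg)
      have "0 \<le> C / sqrt 2 * ?b n" using C by (intro mult_nonneg_nonneg[OF _ b]) simp
      then have "0 \<le> a n" using elim(1) by linarith
      with b elim(1) show ?case unfolding real_norm_def by (simp only: abs_of_nonneg)
    qed
    show ?thesis
    proof (rule bigthetaI)
      show "a \<in> O(?b)"
        by (rule bigoI[where c="C / sqrt \<gamma>"]) (use ev in \<open>auto elim: eventually_mono\<close>)
      show "a \<in> \<Omega>(?b)"
        by (rule landau_omega.bigI[where c="C / sqrt 2"]) (use ev C in \<open>auto elim: eventually_mono\<close>)
    qed
  qed
  let ?F = "prob_filter M"
  let ?z = "\<lambda>t p. path_count t (fst p) (snd p) / (real (fst p) ^ t * q (fst p) ^ (t - 1))"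
  let ?w = "\<lambda>p. cycle_count (fst p) (snd p) / (real (fst p) ^ 6 * q (fst p) ^ 5) / cycle_mean (fst p)"
  have z: "(?z t \<longlongrightarrow> c t) ?F" if "1 \<le> t" for t
    using path_count_limit[OF that] by (simp add: c_def case_prod_unfold)
  have w: "(?w \<longlongrightarrow> 1) ?F"
    using cycle_count_limit by (simp only: case_prod_unfold)
  have n: "((\<lambda>p. (real (fst p) - 1) / real (fst p)) \<longlongrightarrow> 1) ?F"
  proof (rule filterlim_compose[OF _ filterlim_fst_prob_filter])
    have "(\<lambda>n. 1 - 1 / real n) \<longlonglongrightarrow> 1 - 0" by (intro tendsto_intros lim_const_over_n)
    then have "(\<lambda>n. 1 - 1 / real n) \<longlonglongrightarrow> 1" by simp
    then show "(\<lambda>n. (real n - 1) / real n) \<longlonglongrightarrow> 1"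
      by (rule Lim_transform_eventually)
         (auto intro!: eventually_mono[OF eventually_gt_at_top[of 0]] simp: field_simps)
  qed
  \<comment> \<open>The right-hand side of \<open>ratio_identity\<close>, with the cycle term
    expressed through \<open>?w\<close>. Its limit follows from those of the individual counts
    because \<open>c 2\<close> and \<open>D\<close> are nonzero.\<close>
  let ?G = "\<lambda>p. (?z 4 p * ?z 2 p - (?z 3 p)\<^sup>2) / D * (c 2 / ?z 2 p) * ((real (fst p) - 1) / real (fst p)) * sqrt (1 / ?w p)"
  have "(?G \<longlongrightarrow> (c 4 * c 2 - (c 3)\<^sup>2) / D * (c 2 / c 2) * 1 * sqrt (1 / 1)) ?F"
    using D c2 by (intro tendsto_intros z w n) auto
  then have G: "(?G \<longlongrightarrow> 1) ?F" using D c2 by (simp add: D_def)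
  have ev_n: "\<forall>\<^sub>F p in ?F. 2 \<le> fst p \<and> \<gamma> \<le> cycle_mean (fst p)"
    using filterlim_fst_prob_filter[of M] eventually_conj[OF eventually_ge_at_top[of 2] \<gamma>(2)]
    unfolding filterlim_iff by (auto elim: eventually_mono)
  \<comment> \<open>Positive limits make \<open>?z 2\<close> and \<open>?w\<close> eventually
    positive along the filter, as \<open>ratio_identity\<close> requires; this also excludes the
    junk values of division by zero.\<close>
  have z2: "(?z 2 \<longlongrightarrow> c 2) ?F" by (rule z) simp
  have "\<forall>\<^sub>F p in ?F. ?G p = count_ratio (fst p) (snd p) / a (fst p)"
    using ev_n order_tendstoD(1)[OF z2 c2] order_tendstoD(1)[OF w zero_less_one]
  proof eventually_elim
    case (elim p)
    obtain k \<omega> where p: "p = (k, \<omega>)" by (cases p)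
    have k: "2 \<le> k" "\<gamma> \<le> cycle_mean k" using elim p by auto
    have m: "0 < cycle_mean k" using k \<gamma>(1) by linarith
    have qk: "0 < q k" using k by (intro q_pos) auto
    have kq: "real k ^ t * q k ^ s \<noteq> 0" for t s using qk k by simp
    define z where "z t = ?z t p" for t
    define z6 where "z6 = cycle_count k \<omega> / (real k ^ 6 * q k ^ 5)"
    have wz: "?w p = z6 / cycle_mean k" by (simp add: z6_def p)
    have "0 < z 2" using elim by (simp add: z_def p)
    moreover have "0 < z6" using elim(3) m unfolding wz by (simp add: zero_less_divide_iff)
    moreover have P: "path_count 4 k \<omega> = real k ^ 4 * q k ^ 3 * z 4" "path_count 3 k \<omega> = real k ^ 3 * q k ^ 2 * z 3"
      "path_count 2 k \<omega> = real k ^ 2 * q k * z 2" "cycle_count k \<omega> = real k ^ 6 * q k ^ 5 * z6"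
      using kq[of 4 3] kq[of 3 2] kq[of 2 1] kq[of 6 5] by (simp_all add: z_def z6_def p)
    ultimately have "count_ratio k \<omega> / a k =
        (z 4 * z 2 - (z 3)\<^sup>2) / D * (c 2 / z 2) * ((real k - 1) / real k) * sqrt (cycle_mean k / z6)"
      using ratio_identity[of "real k" "q k" "cycle_mean k" "c 2" D "z 2" z6 "z 4" "z 3"] k m qk c2 D
      unfolding count_ratio_def a_def P by simp
    also have "cycle_mean k / z6 = 1 / (z6 / cycle_mean k)" by simp
    finally show ?case unfolding wz[symmetric] unfolding z_def by (simp add: p)
  qed
  from Lim_transform_eventually[OF G this] have "((\<lambda>(n, \<omega>). count_ratio n \<omega> / a n) \<longlongrightarrow> 1) ?F"
    by (simp only: case_prod_unfold)
  with a_nz a_Theta show ?thesis by blast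
qed

lemma AE_sample_in_cube: "1 \<le> n \<Longrightarrow> AE \<omega> in M n. \<forall>i\<in>{1..n}. X n i \<omega> \<in> cbox 0 1"
proof -
  assume n: "1 \<le> n"
  interpret prob_space "M n" using n by (rule prob_M)
  have "AE \<omega> in M n. X n i \<omega> \<in> cbox 0 1" if i: "i \<in> {1..n}" for i
  proof -
    have "X n i \<in> measurable (M n) borel" using indep_X[OF n] i by (auto simp: indep_vars_def)
    moreover have "AE y in distr (M n) borel (X n i). y \<in> cbox 0 1" unfolding distr_X[OF n i] by (rule AE_F_cbox)
    ultimately show ?thesis by (subst (asm) AE_distr_iff) auto
  qed
  then show ?thesis by (intro AE_finite_allI) auto
qed

text \<open>The kernel can be 1 on the diagonal where the adjacency matrix is 0, but distinct tuples
  never see the diagonal. The closing edge of the cycle joins \<open>last v\<close> to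
  \<open>hd v\<close>.\<close>

lemma count_sums_eq:
  assumes B: "\<And>i j. i \<in> {1..n} \<Longrightarrow> j \<in> {1..n} \<Longrightarrow> B i j = rgg_adj (r n) (\<lambda>i. X n i \<omega>) i j"
    and X: "\<forall>i\<in>{1..n}. X n i \<omega> \<in> cbox 0 1"
  shows "sqrt 2 * T_stat n B / (real n ^ 5 * A_bar n B * sigma_hat_2 n B) = count_ratio n \<omega>"
proof -
  have k: "B i j = kern n (X n i \<omega>) (X n j \<omega>)" if "i \<in> {1..n}" "j \<in> {1..n}" "i \<noteq> j" for i j
    using that X by (simp add: B rgg_adj_eq_torus_kernel)
  have p2: "(\<Sum>v\<in>distinct_tuples 2 n. B (v!0) (v!1)) = path_count 2 n \<omega>"
    unfolding path_count_def
    by (intro sum.cong refl) (auto simp: distinct_tuples_def numeral_eq_Suc length_Suc_conv k)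
  have p3: "(\<Sum>v\<in>distinct_tuples 3 n. B (v!0) (v!1) * B (v!1) (v!2)) = path_count 3 n \<omega>"
    unfolding path_count_def
    by (intro sum.cong refl) (auto simp: distinct_tuples_def numeral_eq_Suc length_Suc_conv k)
  have p4: "(\<Sum>v\<in>distinct_tuples 4 n. B (v!0) (v!1) * B (v!1) (v!2) * B (v!2) (v!3)) = path_count 4 n \<omega>"
    unfolding path_count_def
    by (intro sum.cong refl) (auto simp: distinct_tuples_def numeral_eq_Suc length_Suc_conv k)
  have c6: "(\<Sum>v\<in>distinct_tuples 6 n. B (v!0) (v!1) * B (v!1) (v!2) * B (v!2) (v!3) * B (v!3) (v!4) * B (v!4) (v!5) * B (v!5) (v!0))
      = cycle_count n \<omega>"
    unfolding cycle_count_def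
    by (intro sum.cong refl) (auto simp: distinct_tuples_def numeral_eq_Suc length_Suc_conv k)
  show ?thesis unfolding T_stat_def A_bar_def sigma_hat_2_def count_ratio_def p2 p3 p4 c6 ..
qed

end

section \<open>Measurability of the statistic and its asymptotic order\<close>

lemma measurable_statistic:
  assumes B: "\<And>i j. i \<in> {1..n} \<Longrightarrow> j \<in> {1..n} \<Longrightarrow> (\<lambda>\<omega>. B \<omega> i j) \<in> borel_measurable N"
  shows "(\<lambda>\<omega>. sqrt 2 * T_stat n (B \<omega>) / (real n ^ 5 * A_bar n (B \<omega>) * sigma_hat_2 n (B \<omega>))) \<in> borel_measurable N"
proof -
  have [measurable]: "(\<lambda>\<omega>. \<Sum>v\<in>distinct_tuples 2 n. B \<omega> (v!0) (v!1)) \<in> borel_measurable N"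
    by (intro borel_measurable_sum borel_measurable_times B distinct_tuples_nth[of _ 2]) auto
  have [measurable]: "(\<lambda>\<omega>. \<Sum>v\<in>distinct_tuples 3 n. B \<omega> (v!0) (v!1) * B \<omega> (v!1) (v!2)) \<in> borel_measurable N"
    by (intro borel_measurable_sum borel_measurable_times B distinct_tuples_nth[of _ 3]) auto
  have [measurable]: "(\<lambda>\<omega>. \<Sum>v\<in>distinct_tuples 4 n. B \<omega> (v!0) (v!1) * B \<omega> (v!1) (v!2) * B \<omega> (v!2) (v!3)) \<in> borel_measurable N"
    by (intro borel_measurable_sum borel_measurable_times B distinct_tuples_nth[of _ 4]) auto
  have [measurable]: "(\<lambda>\<omega>. \<Sum>v\<in>distinct_tuples 6 n. B \<omega> (v!0) (v!1) * B \<omega> (v!1) (v!2) * B \<omega> (v!2) (v!3) *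
        B \<omega> (v!3) (v!4) * B \<omega> (v!4) (v!5) * B \<omega> (v!5) (v!0)) \<in> borel_measurable N"
    by (intro borel_measurable_sum borel_measurable_times B distinct_tuples_nth[of _ 6]) auto
  show ?thesis unfolding T_stat_def A_bar_def sigma_hat_2_def by measurable
qed

lemma measurable_rgg_adj:
  assumes [measurable]: "x i \<in> borel_measurable N" "x j \<in> borel_measurable N"
  shows "(\<lambda>\<omega>. rgg_adj r (\<lambda>k. x k \<omega>) i j) \<in> borel_measurable N"
proof -
  have c [measurable]: "(\<lambda>y::real^'m. y $ k) \<in> borel_measurable borel" for k
    by (intro borel_measurable_continuous_onI continuous_intros)
  have "Measurable.pred N (\<lambda>\<omega>. \<forall>k\<in>UNIV. min \<bar>x i \<omega> $ k - x j \<omega> $ k\<bar> (1 - \<bar>x i \<omega> $ k - x j \<omega> $ k\<bar>) \<le> r)"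
    by (intro pred_intros_finite) measurable
  then have [measurable]: "Measurable.pred N (\<lambda>\<omega>. torus_dist (x i \<omega>) (x j \<omega>) \<le> r)"
    by (simp add: torus_dist_le_iff)
  show ?thesis unfolding rgg_adj_def by measurable
qed

theorem theorem3p3:
  fixes r :: "nat \<Rightarrow> real"
    and F :: "(real ^ 'm) measure"
    and f :: "real ^ 'm \<Rightarrow> real"
    and M :: "nat \<Rightarrow> 'a measure"
    and A :: "nat \<Rightarrow> 'a \<Rightarrow> nat \<Rightarrow> nat \<Rightarrow> real"
  assumes r_range: "\<And>n. n \<ge> 1 \<Longrightarrow> 0 < r n \<and> r n < 1/2"
    and r_small: "r \<in> o(\<lambda>_. 1)"
    and dense: "(\<lambda>n. real n * r n ^ CARD('m)) \<in> \<omega>(\<lambda>_. 1)"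
    and F_prob: "prob_space F"
    and f_cont: "continuous_on (cbox 0 1) f"
    and f_nonneg: "\<And>x. x \<in> cbox 0 1 \<Longrightarrow> f x \<ge> 0"
    and F_density: "F = density lborel (\<lambda>x. ennreal (indicator (cbox 0 1) x * f x))"
    and graph: "\<And>n. n \<ge> 1 \<Longrightarrow> random_geometric_graph (M n) n (r n) F (A n)"
    and H1: "F \<noteq> uniform_measure lborel (cbox 0 1)"
  shows "Theta_in_probability M
           (\<lambda>n \<omega>. sqrt 2 * T_stat n (A n \<omega>) /
                   (real n ^ 5 * A_bar n (A n \<omega>) * sigma_hat_2 n (A n \<omega>)))
           (\<lambda>n. sqrt (real n) * sqrt (real n * r n ^ CARD('m)) * Delta f)"
proof -
  have prob_M: "prob_space (M n)" if "1 \<le> n" for n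
    using graph[OF that] by (simp add: random_geometric_graph_def)
  have "\<forall>n\<in>{1..}. \<exists>Y. prob_space.indep_vars (M n) (\<lambda>_. borel) Y {1..n} \<and>
          (\<forall>i\<in>{1..n}. distr (M n) borel (Y i) = F) \<and>
          (\<forall>\<omega>\<in>space (M n). \<forall>i\<in>{1..n}. \<forall>j\<in>{1..n}. A n \<omega> i j = rgg_adj (r n) (\<lambda>k. Y k \<omega>) i j)"
    using graph by (auto simp: random_geometric_graph_def)
  from bchoice[OF this] obtain X where X: "\<forall>n\<in>{1..}. prob_space.indep_vars (M n) (\<lambda>_. borel) (X n) {1..n} \<and>
          (\<forall>i\<in>{1..n}. distr (M n) borel (X n i) = F) \<and>
          (\<forall>\<omega>\<in>space (M n). \<forall>i\<in>{1..n}. \<forall>j\<in>{1..n}. A n \<omega> i j = rgg_adj (r n) (\<lambda>k. X n k \<omega>) i j)"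
    by blast
  have indep_X: "prob_space.indep_vars (M n) (\<lambda>_. borel) (X n) {1..n}" if "1 \<le> n" for n
    using X that by simp
  have distr_X: "distr (M n) borel (X n i) = F" if "1 \<le> n" "i \<in> {1..n}" for n i
    using X that by simp
  have A_eq: "A n \<omega> i j = rgg_adj (r n) (\<lambda>k. X n k \<omega>) i j"
    if "1 \<le> n" "\<omega> \<in> space (M n)" "i \<in> {1..n}" "j \<in> {1..n}" for n \<omega> i j
    using X that by simp
  have "bounded (f ` cbox 0 1)"
    by (intro compact_imp_bounded compact_continuous_image f_cont compact_cbox)
  then obtain K where K: "0 < K" "\<And>x. x \<in> cbox 0 1 \<Longrightarrow> f x \<le> K"
    by (auto simp: bounded_pos abs_le_iff)
  have r_pos: "0 < r n" "r n \<noteq> 0" if "1 \<le> n" for n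
    using r_range[OF that] by auto
  have r_lim: "filterlim r (at_right 0) sequentially"
    unfolding filterlim_at using smalloD_tendsto[OF r_small] r_pos
    by (auto intro!: eventually_mono[OF eventually_ge_at_top[of 1]])
  have "filterlim (\<lambda>n. real n * r n ^ CARD('m)) at_infinity sequentially"
    using smallomegaD_filterlim_at_infinity[OF dense] by simp
  then have dense': "filterlim (\<lambda>n. real n * r n ^ CARD('m)) at_top sequentially"
    by (rule filterlim_at_infinity_imp_filterlim_at_top)
       (auto intro!: eventually_mono[OF eventually_ge_at_top[of 1]] simp: r_pos less_imp_le)
  interpret rgg_sequence F f K M X r
    using F_prob f_cont f_nonneg K F_density prob_M indep_X distr_X r_pos r_lim dense'
    by (intro rgg_sequence.intro cube_density.intro cube_density_axioms.intro rgg_sequence_axioms.intro) auto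
  let ?Y = "\<lambda>n \<omega>. sqrt 2 * T_stat n (A n \<omega>) / (real n ^ 5 * A_bar n (A n \<omega>) * sigma_hat_2 n (A n \<omega>))"
  obtain a where a: "\<And>n. 1 \<le> n \<Longrightarrow> a n \<noteq> 0"
      "a \<in> \<Theta>(\<lambda>n. sqrt (real n) * sqrt (real n * r n ^ CARD('m)) * Delta f)"
      "((\<lambda>(n, \<omega>). count_ratio n \<omega> / a n) \<longlongrightarrow> 1) (prob_filter M)"
    using count_ratio_limit[OF Delta_pos[OF H1]] by blast
  have "\<forall>\<^sub>F p in prob_filter M. count_ratio (fst p) (snd p) / a (fst p) = ?Y (fst p) (snd p) / a (fst p)"
  proof (rule eventually_prob_filter_AE)
    fix n :: nat assume n: "1 \<le> n"
    show "AE \<omega> in M n. count_ratio (fst (n, \<omega>)) (snd (n, \<omega>)) / a (fst (n, \<omega>)) = ?Y (fst (n, \<omega>)) (snd (n, \<omega>)) / a (fst (n, \<omega>))"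
      using AE_sample_in_cube[OF n] AE_space
    proof eventually_elim
      case (elim \<omega>)
      have "?Y n \<omega> = count_ratio n \<omega>"
        by (rule count_sums_eq[OF A_eq[OF n elim(2)] elim(1)])
      then show ?case by simp
    qed
  qed
  from Lim_transform_eventually[OF a(3)[unfolded case_prod_unfold] this]
  have "((\<lambda>p. ?Y (fst p) (snd p) / a (fst p) - 1) \<longlongrightarrow> 0) (prob_filter M)"
    by (rule LIM_zero)
  then have lim: "((\<lambda>(n, \<omega>). ?Y n \<omega> / a n - 1) \<longlongrightarrow> 0) (prob_filter M)" by (simp only: case_prod_unfold)
  \<comment> \<open>\<open>o_P_one\<close> demands measurability itself, not up to null sets.
    \<open>A n\<close> agrees with the adjacency matrix of the sample at every point of the space,
    so it is inherited from the sample.\<close>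
  have meas: "?Y n \<in> borel_measurable (M n)" if n: "1 \<le> n" for n
  proof (rule measurable_statistic)
    interpret prob_space "M n" using n by (rule prob_M)
    fix i j assume ij: "i \<in> {1..n}" "j \<in> {1..n}"
    have "X n i \<in> borel_measurable (M n)" "X n j \<in> borel_measurable (M n)"
      using indep_X[OF n] ij by (auto simp: indep_vars_def)
    then have "(\<lambda>\<omega>. rgg_adj (r n) (\<lambda>k. X n k \<omega>) i j) \<in> borel_measurable (M n)"
      by (rule measurable_rgg_adj)
    then show "(\<lambda>\<omega>. A n \<omega> i j) \<in> borel_measurable (M n)"
      by (subst measurable_cong[OF A_eq[OF n _ ij]])
  qed
  \<comment> \<open>The relative error is read off from \<open>?Y\<close> and \<open>a\<close>; as
    \<open>a n\<close> is nonzero for every \<open>n \<ge> 1\<close>, the factorisation is exact at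
    every sample point.\<close>
  have "o_P_one M (\<lambda>n \<omega>. ?Y n \<omega> / a n - 1)"
    by (rule o_P_one_prob_filter[OF _ prob_M lim]) (use meas in measurable)
  with a show ?thesis
    unfolding Theta_in_probability_def by (intro exI[of _ a] exI[of _ "\<lambda>n \<omega>. ?Y n \<omega> / a n - 1"]) auto
qed

end
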